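(* Let $1<p<\infty$ and $p<s\le\infty$. Let $(R,\mu)$ be a $\sigma$-finite nonatomic measure space. Then, for any function $f\in L^{p,s}(R,\mu)$, $$\|f\|_{p,s}\le c_{p,s}\|f\|'_{p,s},\qquad\text{where}\qquad c_{p,s}=\left(\frac{p}{s}\right)^{1/s}\left(\frac{p'}{s'}\right)^{1/s'}.$$ The constant $c_{p,s}$ is optimal, i.e. it cannot be replaced by a smaller constant for which the inequality holds for all such $(R,\mu)$ and all $f\in L^{p,s}(R,\mu)$.
   Context: Functions are real-valued, measurable and finite a.e. For a $\mu$-measurable function $f$ on $R$, $f^*$ denotes its non-increasing rearrangement on $\mathbb{R}_+=(0,\infty)$. For $1<p<\infty$ and $1\le s<\infty$, $$\|f\|_{p,s}=\left(\int_0^\infty (t^{1/p}f^*(t))^s\,\frac{dt}{t}\right)^{1/s},\qquad \|f\|_{p,\infty}=\sup_{t>0}t^{1/p}f^*(t),$$ and $L^{p,s}(R,\mu)$ is the set of $f$ with $\|f\|_{p,s}<\infty$. Conjugate exponents: $1/p+1/p'=1$, $1/s+1/s'=1$ ($s'=1$ if $s=\infty$). Convention: $(p/s)^{1/s}=1$ for $s=\infty$, so $c_{p,\infty}=p'$. Dual norm: $\|f\|'_{p,s}=\sup\left\{\int_R fg\,d\mu:\ g\in L^{p',s'}(R,\mu),\ \|g\|_{p',s'}=1\right\}$. *)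

theory Defs
  imports "HOL-Analysis.Analysis"
begin

definition atom_of :: "'a measure \<Rightarrow> 'a set \<Rightarrow> bool" where
  "atom_of M A \<longleftrightarrow> A \<in> sets M \<and> 0 < emeasure M A \<and>
     (\<forall>B\<in>sets M. B \<subseteq> A \<longrightarrow> emeasure M B < emeasure M A \<longrightarrow> emeasure M B = 0)"

definition nonatomic :: "'a measure \<Rightarrow> bool" where
  "nonatomic M \<longleftrightarrow> (\<nexists>A. atom_of M A)"

(* Powers of extended nonnegative numbers; only exponents a > 0 are used below,
   and for those top is sent to top and 0 to 0. *)
definition ennreal_powr :: "ennreal \<Rightarrow> real \<Rightarrow> ennreal" where
  "ennreal_powr x a = (if x = \<infinity> then \<infinity> else ennreal (enn2real x powr a))"

definition conj_exponent :: "real \<Rightarrow> real" where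
  "conj_exponent p = p / (p - 1)"

definition conj_exponent_ext :: "ennreal \<Rightarrow> ennreal" where
  "conj_exponent_ext s =
     (if s = \<infinity> then 1 else if s = 1 then \<infinity> else ennreal (conj_exponent (enn2real s)))"

lemma conj_exponent_sum:
  assumes "1 < p"
  shows "1 / p + 1 / conj_exponent p = 1"
  using assms by (simp add: conj_exponent_def field_simps)

lemma conj_exponent_ext_sum:
  assumes "1 \<le> s"
  shows "1 / s + 1 / conj_exponent_ext s = 1"
proof (cases s)
  case (real r)
  have "1 \<le> r" using assms real ennreal_le_iff[of r 1] by simp
  show ?thesis
  proof (cases "r = 1")
    case True
    then show ?thesis using real by (simp add: conj_exponent_ext_def)
  next
    case False
    with \<open>1 \<le> r\<close> have r: "1 < r" by simp
    then have c: "0 < conj_exponent r" by (simp add: conj_exponent_def)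
    have "s \<noteq> 1" using real r by simp
    then have "conj_exponent_ext s = ennreal (conj_exponent r)"
      using real by (simp add: conj_exponent_ext_def)
    moreover have "1 / ennreal r = ennreal (1 / r)"
      using r divide_ennreal[of 1 r] by simp
    moreover have "1 / ennreal (conj_exponent r) = ennreal (1 / conj_exponent r)"
      using c divide_ennreal[of 1 "conj_exponent r"] by simp
    moreover have "ennreal (1 / r) + ennreal (1 / conj_exponent r)
        = ennreal (1 / r + 1 / conj_exponent r)"
      by (rule ennreal_plus[symmetric]) (use r c in auto)
    ultimately show ?thesis
      using real conj_exponent_sum[OF r] by simp
  qed
next
  case top
  then show ?thesis by (simp add: conj_exponent_ext_def)
qed

(* The value is infinite when no level set of f has measure at most t. *)
definition rearrangement :: "'a measure \<Rightarrow> ('a \<Rightarrow> real) \<Rightarrow> real \<Rightarrow> ennreal" where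
  "rearrangement M f t =
     Inf {ennreal y | y. 0 \<le> y \<and> emeasure M {x \<in> space M. y < \<bar>f x\<bar>} \<le> ennreal t}"

definition lorentz_norm :: "'a measure \<Rightarrow> real \<Rightarrow> ennreal \<Rightarrow> ('a \<Rightarrow> real) \<Rightarrow> ennreal" where
  "lorentz_norm M p s f =
     (if s = \<infinity> then (SUP t\<in>{0<..}. ennreal (t powr (1 / p)) * rearrangement M f t)
      else ennreal_powr
        (\<integral>\<^sup>+t\<in>{0<..}. ennreal_powr (ennreal (t powr (1 / p)) * rearrangement M f t) (enn2real s)
            * ennreal (1 / t) \<partial>lborel)
        (1 / enn2real s))"

definition lorentz_space :: "'a measure \<Rightarrow> real \<Rightarrow> ennreal \<Rightarrow> ('a \<Rightarrow> real) set" where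
  "lorentz_space M p s = {f \<in> borel_measurable M. lorentz_norm M p s f < \<infinity>}"

(* By Hoelder's inequality f * g is integrable whenever f is in lorentz_space M p s, so the
   Bochner integral is the intended one.  The set of admissible g is closed under negation, so
   truncating negative integrals at 0 does not change the supremum.  If there is no admissible g
   (measure identically zero), the supremum, taken in [0, top], is 0. *)
definition lorentz_dual_norm :: "'a measure \<Rightarrow> real \<Rightarrow> ennreal \<Rightarrow> ('a \<Rightarrow> real) \<Rightarrow> ennreal" where
  "lorentz_dual_norm M p s f =
     Sup {ennreal (\<integral>x. f x * g x \<partial>M) | g.
       g \<in> lorentz_space M (conj_exponent p) (conj_exponent_ext s) \<and>
       lorentz_norm M (conj_exponent p) (conj_exponent_ext s) g = 1}"

(* Used for p < s only, where the conjugate of s is finite. *)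
definition lorentz_const :: "real \<Rightarrow> ennreal \<Rightarrow> real" where
  "lorentz_const p s =
     (let s' = enn2real (conj_exponent_ext s) in
      (if s = \<infinity> then 1 else (p / enn2real s) powr (1 / enn2real s))
        * (conj_exponent p / s') powr (1 / s'))"

end

theory Submission
  imports Defs
begin

text \<open>
  Monotone approximation reduces the inequality to a step function \<open>f\<close>. For \<open>s < \<infinity>\<close> put
  \<open>\<theta> = 1 - s'/p'\<close> and test with \<open>g = h ^ (s - 1)\<close>, where \<open>h\<close> is the least decreasing majorant of
  \<open>t ^ \<theta> * f\<^sup>*(t)\<close>; it is constant on each step of \<open>f\<close>. Let \<open>A = \<integral> f g\<close>, \<open>B = \<parallel>f\<parallel> ^ s\<close> and
  \<open>D = \<parallel>g\<parallel> ^ s'\<close>. Summation by parts gives the linear inequality \<open>(s/p) B + (s - 1) (s'/p') D \<le> s A\<close>,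
  which is an equality in the two extremal cases, \<open>f\<close> an indicator and \<open>t ^ \<theta> * f\<^sup>*(t)\<close> decreasing.
  Young's inequality turns it into \<open>((s/p) B) ^ (1/s) * ((s'/p') D) ^ (1/s') \<le> A\<close>, which is the claim.
  For \<open>s = \<infinity>\<close> the indicators of the sets \<open>{\<bar>f\<bar> \<ge> v}\<close> suffice as test functions.

  The constant is attained by the indicator of the unit interval: by Chebyshev's inequality for the
  decreasing functions \<open>g\<^sup>* ^ s'\<close> and \<open>t ^ (s'/p' - 1)\<close>, followed by convexity, its dual norm is at most
  \<open>(s'/p') ^ (1/s')\<close>.
\<close>

section \<open>The discrete inequality\<close>

text \<open>The convex function \<open>x powr s\<close> lies above its tangent at \<open>h\<close>;
  Young's inequality with exponents \<open>s\<close> and \<open>s / (s - 1)\<close> gives this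
  without calculus.\<close>

lemma young_powr:
  fixes x h s :: real
  assumes "1 < s" "0 \<le> x" "0 \<le> h"
  shows "s * x * h powr (s - 1) \<le> x powr s + (s - 1) * h powr s"
proof -
  have "x * h powr (s - 1) \<le> x powr s / s + (h powr (s - 1)) powr (s / (s - 1)) / (s / (s - 1))"
    using assms by (intro Youngs_inequality) (auto simp: field_simps)
  also have "(h powr (s - 1)) powr (s / (s - 1)) = h powr s"
    using assms by (simp add: powr_powr)
  finally have "s * (x * h powr (s - 1)) \<le> s * (x powr s / s + h powr s / (s / (s - 1)))"
    using assms by (intro mult_left_mono) auto
  also have "\<dots> = x powr s + (s - 1) * h powr s" using assms by (simp add: distrib_left)
  finally show ?thesis by (simp add: mult.assoc)
qed

text \<open>
  \<open>potential s \<theta> t v h\<close> is the antiderivative in \<open>t\<close> of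
  \<open>s v h\<^sup>s\<^sup>-\<^sup>1 - q v\<^sup>s t\<^sup>q\<^sup>-\<^sup>1 - (s - 1) (1 - \<theta>) h\<^sup>s t\<^sup>-\<^sup>\<theta>\<close>, where \<open>q = 1 + \<theta> (s - 1)\<close>.
\<close>

definition potential :: "real \<Rightarrow> real \<Rightarrow> real \<Rightarrow> real \<Rightarrow> real \<Rightarrow> real" where
  "potential s \<theta> t v h =
     s * v * h powr (s - 1) * t - v powr s * t powr (1 + \<theta> * (s - 1)) - (s - 1) * h powr s * t powr (1 - \<theta>)"

text \<open>In terms of \<open>x = v * t powr \<theta>\<close> the bracket is minus the gap in
  \<open>young_powr\<close>: for nonnegative \<open>h\<close> it is never positive, and it vanishes
  for \<open>h = x\<close>.\<close>

lemma potential_eq: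
  assumes "0 \<le> t" "0 \<le> v"
  shows "potential s \<theta> t v h = t powr (1 - \<theta>) *
    (s * (v * t powr \<theta>) * h powr (s - 1) - (v * t powr \<theta>) powr s - (s - 1) * h powr s)"
proof (cases "t = 0")
  case False
  then have "t powr (1 - \<theta>) * t powr \<theta> = t"
    using assms by (simp add: powr_add[symmetric])
  moreover have "t powr (1 - \<theta>) * (v * t powr \<theta>) powr s = v powr s * t powr (1 + \<theta> * (s - 1))"
  proof -
    have "t powr (1 - \<theta>) * (v * t powr \<theta>) powr s = v powr s * (t powr (1 - \<theta>) * t powr (\<theta> * s))"
      using assms by (simp add: powr_mult powr_powr)
    also have "t powr (1 - \<theta>) * t powr (\<theta> * s) = t powr (1 + \<theta> * (s - 1))"
      by (simp add: powr_add[symmetric] algebra_simps)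
    finally show ?thesis .
  qed
  ultimately show ?thesis
    unfolding potential_def by (simp add: right_diff_distrib)
qed (simp add: potential_def)

text \<open>At a breakpoint \<open>t\<close> the step value falls from \<open>v\<close> to
  \<open>v'\<close> and the majorant changes from \<open>h\<close> to \<open>h'\<close>. Either the
  majorant does not jump, and the bracket of \<open>potential_eq\<close> increases in
  \<open>x\<close> up to \<open>h\<close>; or \<open>h = x\<close>, and the bracket takes its
  maximum 0.\<close>

lemma potential_mono:
  assumes "1 < s" "0 \<le> \<theta>" "0 \<le> t" "0 \<le> v'" "v' \<le> v" "0 \<le> h'" "v * t powr \<theta> \<le> h"
    and "h = h' \<or> h = v * t powr \<theta>"
  shows "potential s \<theta> t v' h' \<le> potential s \<theta> t v h"
proof -
  define x x' where "x = v * t powr \<theta>" and "x' = v' * t powr \<theta>"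
  have x: "0 \<le> x'" "x' \<le> x" "x \<le> h"
    using assms by (auto simp: x_def x'_def intro: mult_right_mono)
  have "s * x' * h' powr (s - 1) - x' powr s - (s - 1) * h' powr s
      \<le> s * x * h powr (s - 1) - x powr s - (s - 1) * h powr s"
    using assms(8)
  proof
    assume "h = h'"
    \<comment> \<open>The tangent at \<open>x\<close> bounds the increment from \<open>x'\<close> to
      \<open>x\<close> by means of the slope at \<open>x\<close>, hence of the larger slope at
      \<open>h\<close>.\<close>
    have "s * x' * x powr (s - 1) \<le> x' powr s + (s - 1) * x powr s"
      using x assms by (intro young_powr) auto
    moreover have "x powr s = x * x powr (s - 1)"
      using x assms by (cases "x = 0") (auto simp: powr_diff)
    ultimately have "x powr s - x' powr s \<le> s * (x - x') * x powr (s - 1)"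
      by (simp add: algebra_simps)
    also have "\<dots> \<le> s * (x - x') * h powr (s - 1)"
      using x assms by (intro mult_left_mono powr_mono2) auto
    finally show ?thesis using \<open>h = h'\<close> by (simp add: algebra_simps)
  next
    assume "h = v * t powr \<theta>"
    then have "h = x" by (simp add: x_def)
    moreover have "x powr s = x * x powr (s - 1)"
      using x assms by (cases "x = 0") (auto simp: powr_diff)
    ultimately have "s * x * h powr (s - 1) - x powr s - (s - 1) * h powr s = 0"
      by (simp add: algebra_simps)
    then show ?thesis using young_powr[of s x' h'] x assms by simp
  qed
  then show ?thesis
    using assms by (simp add: potential_eq x_def x'_def mult_left_mono)
qed

text \<open>Summation by parts: the boundary terms vanish because \<open>T 0 = 0\<close> and
  \<open>v n = h n = 0\<close>, and by \<open>potential_mono\<close> every breakpoint contributes a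
  nonnegative jump.\<close>

lemma sum_potential_nonneg:
  fixes T v h :: "nat \<Rightarrow> real"
  assumes s: "1 < s" and \<theta>: "0 \<le> \<theta>"
    and T: "T 0 = 0" "\<And>k. 0 \<le> T k"
    and v: "\<And>k. 0 \<le> v k" "\<And>k. v (Suc k) \<le> v k" "v n = 0"
    and h: "\<And>k. k \<le> n \<Longrightarrow> 0 \<le> h k" "h n = 0"
      "\<And>k. k < n \<Longrightarrow> v k * T (Suc k) powr \<theta> \<le> h k"
      "\<And>k. k < n \<Longrightarrow> h k = h (Suc k) \<or> h k = v k * T (Suc k) powr \<theta>"
  shows "0 \<le> (\<Sum>k<n. potential s \<theta> (T (Suc k)) (v k) (h k) - potential s \<theta> (T k) (v k) (h k))"
proof -
  \<comment> \<open>The partial sums are compared with the potential just to the right of the last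
    breakpoint reached, which vanishes for \<open>j = n\<close>.\<close>
  have "potential s \<theta> (T j) (v j) (h j)
      \<le> (\<Sum>k<j. potential s \<theta> (T (Suc k)) (v k) (h k) - potential s \<theta> (T k) (v k) (h k))"
    if "j \<le> n" for j
    using that
  proof (induction j)
    case 0
    then show ?case using T by (simp add: potential_def)
  next
    case (Suc j)
    have "potential s \<theta> (T (Suc j)) (v (Suc j)) (h (Suc j)) \<le> potential s \<theta> (T (Suc j)) (v j) (h j)"
      using assms Suc.prems by (intro potential_mono) auto
    then show ?case using Suc by simp
  qed
  from this[of n] show ?thesis using v h by (simp add: potential_def)
qed

text \<open>The least non-increasing majorant of \<open>u\<close> on \<open>{..n}\<close>.\<close>

definition tail_max :: "nat \<Rightarrow> (nat \<Rightarrow> real) \<Rightarrow> nat \<Rightarrow> real" where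
  "tail_max n u k = Max (u ` {k..n})"

lemma tail_max_last: "tail_max n u n = u n"
  by (simp add: tail_max_def)

lemma tail_max_step:
  assumes "k < n"
  shows "tail_max n u k = max (u k) (tail_max n u (Suc k))"
proof -
  have "{k..n} = insert k {Suc k..n}" using assms by auto
  then show ?thesis using assms by (simp add: tail_max_def)
qed

lemma tail_max_ge: "k \<le> j \<Longrightarrow> j \<le> n \<Longrightarrow> u j \<le> tail_max n u k"
  unfolding tail_max_def by (intro Max_ge) auto

lemma tail_max_antimono: "k \<le> j \<Longrightarrow> j \<le> n \<Longrightarrow> tail_max n u j \<le> tail_max n u k"
  unfolding tail_max_def by (intro Max_mono) auto

text \<open>For the test function \<open>g = h powr (s - 1)\<close> the two sums on the left are
  \<open>s / p\<close> times \<open>B\<close> and \<open>s' / p'\<close> times \<open>D\<close>, and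
  the one on the right is \<open>A\<close>; this is the linear inequality announced above. The lower
  bound on \<open>h\<close> serves later to show that \<open>D\<close> is positive.\<close>

lemma step_inequality:
  fixes T v :: "nat \<Rightarrow> real" and p s p' s' :: real
  assumes p: "1 < p" "p < s" and p': "p' = p / (p - 1)" and s': "s' = s / (s - 1)"
    and T: "T 0 = 0" "\<And>k. T k \<le> T (Suc k)"
    and v: "\<And>k. 0 \<le> v k" "\<And>k. v (Suc k) \<le> v k" "v n = 0"
  obtains h where "\<And>k. k \<le> n \<Longrightarrow> 0 \<le> h k" "\<And>i j. i \<le> j \<Longrightarrow> j \<le> n \<Longrightarrow> h j \<le> h i"
    "\<And>k. k < n \<Longrightarrow> v k * T (Suc k) powr ((s - p) / (p * (s - 1))) \<le> h k"
    "(\<Sum>k<n. v k powr s * (T (Suc k) powr (s / p) - T k powr (s / p)))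
      + (s - 1) * (\<Sum>k<n. h k powr s * (T (Suc k) powr (s' / p') - T k powr (s' / p')))
      \<le> s * (\<Sum>k<n. v k * h k powr (s - 1) * (T (Suc k) - T k))"
proof
  define \<theta> where "\<theta> = (s - p) / (p * (s - 1))"
  \<comment> \<open>On step \<open>k\<close> the factor \<open>t powr \<theta>\<close> is largest at
    the right end \<open>T (Suc k)\<close>, so \<open>h\<close> majorizes on the whole step.\<close>
  define h where "h = tail_max n (\<lambda>k. v k * T (Suc k) powr \<theta>)"
  have T0: "0 \<le> T k" for k by (induction k) (use T in \<open>auto intro: order_trans\<close>)
  show h0: "0 \<le> h k" if "k \<le> n" for k
    using tail_max_ge[OF that order_refl, of "\<lambda>k. v k * T (Suc k) powr \<theta>"] v by (simp add: h_def)
  show "h j \<le> h i" if "i \<le> j" "j \<le> n" for i j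
    using that by (simp add: h_def tail_max_antimono)
  show hge: "v k * T (Suc k) powr ((s - p) / (p * (s - 1))) \<le> h k" if "k < n" for k
    using tail_max_ge[of k k n] that by (simp add: h_def \<theta>_def)
  have \<theta>: "0 \<le> \<theta>" using p by (simp add: \<theta>_def)
  \<comment> \<open>This choice of \<open>\<theta>\<close> turns the exponents in
    \<open>potential\<close> into those of the two Lorentz norms.\<close>
  have exps: "1 + \<theta> * (s - 1) = s / p" "1 - \<theta> = s' / p'"
    using p by (simp_all add: \<theta>_def p' s' divide_simps) (simp_all add: algebra_simps)
  have "0 \<le> (\<Sum>k<n. potential s \<theta> (T (Suc k)) (v k) (h k) - potential s \<theta> (T k) (v k) (h k))"
  proof (rule sum_potential_nonneg)
    show "h n = 0" using v by (simp add: h_def tail_max_last)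
    show "h k = h (Suc k) \<or> h k = v k * T (Suc k) powr \<theta>" if "k < n" for k
      using tail_max_step[OF that] by (auto simp: h_def max_def)
  qed (use p \<theta> T T0 v h0 hge in \<open>auto simp: \<theta>_def\<close>)
  also have "\<dots> = s * (\<Sum>k<n. v k * h k powr (s - 1) * (T (Suc k) - T k))
      - (\<Sum>k<n. v k powr s * (T (Suc k) powr (s / p) - T k powr (s / p)))
      - (s - 1) * (\<Sum>k<n. h k powr s * (T (Suc k) powr (s' / p') - T k powr (s' / p')))"
    unfolding potential_def exps sum_distrib_left sum_subtractf[symmetric]
    by (intro sum.cong refl) (simp add: algebra_simps)
  finally show "(\<Sum>k<n. v k powr s * (T (Suc k) powr (s / p) - T k powr (s / p)))
      + (s - 1) * (\<Sum>k<n. h k powr s * (T (Suc k) powr (s' / p') - T k powr (s' / p')))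
      \<le> s * (\<Sum>k<n. v k * h k powr (s - 1) * (T (Suc k) - T k))"
    by simp
qed

section \<open>Rearrangements and their limits\<close>

lemma ennreal_powr_ennreal: "0 \<le> x \<Longrightarrow> ennreal_powr (ennreal x) r = ennreal (x powr r)"
  by (simp add: ennreal_powr_def)

lemma ennreal_powr_inverse:
  assumes "0 < r" "ennreal_powr x r \<le> y"
  shows "x \<le> ennreal_powr y (1 / r)"
proof (cases x)
  case (real a)
  show ?thesis
  proof (cases y)
    case y: (real b)
    have "a powr r \<le> b"
      using assms real y by (simp add: ennreal_powr_ennreal)
    then have "(a powr r) powr (1 / r) \<le> b powr (1 / r)"
      using assms real by (intro powr_mono2) auto
    then show ?thesis using assms real y by (simp add: ennreal_powr_ennreal powr_powr)
  qed (simp add: ennreal_powr_def)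
next
  case top
  then have "y = \<infinity>" using assms by (simp add: ennreal_powr_def top_unique)
  then show ?thesis by (simp add: ennreal_powr_def)
qed

lemma ennreal_powr_mono:
  assumes "0 < r" "x \<le> y"
  shows "ennreal_powr x r \<le> ennreal_powr y r"
proof (cases y)
  case (real b)
  then obtain a where "x = ennreal a" "0 \<le> a"
    using assms by (cases x) (auto simp: top_unique)
  then show ?thesis using real assms by (simp add: ennreal_powr_ennreal powr_mono2)
qed (simp add: ennreal_powr_def)

lemma ennreal_powr_powr:
  assumes "0 < r" shows "ennreal_powr (ennreal_powr x (1 / r)) r = x"
  using assms by (cases x) (auto simp: ennreal_powr_def powr_powr)

text \<open>The powers with exponents \<open>r\<close> and \<open>1 / r\<close> form a Galois
  connection, which makes them commute with suprema.\<close>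

lemma ennreal_powr_le_iff:
  assumes "0 < r"
  shows "ennreal_powr x r \<le> y \<longleftrightarrow> x \<le> ennreal_powr y (1 / r)"
  using ennreal_powr_inverse[OF assms] ennreal_powr_mono[OF assms] ennreal_powr_powr[OF assms]
  by metis

lemma ennreal_powr_SUP:
  assumes "0 < r"
  shows "ennreal_powr (SUP i\<in>I. x i) r = (SUP i\<in>I. ennreal_powr (x i) r)"
proof (rule antisym)
  show "ennreal_powr (SUP i\<in>I. x i) r \<le> (SUP i\<in>I. ennreal_powr (x i) r)"
    unfolding ennreal_powr_le_iff[OF assms]
    by (intro SUP_least, subst ennreal_powr_le_iff[OF assms, symmetric]) (rule SUP_upper)
  show "(SUP i\<in>I. ennreal_powr (x i) r) \<le> ennreal_powr (SUP i\<in>I. x i) r"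
    by (intro SUP_least ennreal_powr_mono assms SUP_upper)
qed

lemma rearrangement_cong:
  assumes "\<And>x. x \<in> space M \<Longrightarrow> \<bar>f x\<bar> = \<bar>g x\<bar>"
  shows "rearrangement M f = rearrangement M g"
proof -
  have "{x \<in> space M. y < \<bar>f x\<bar>} = {x \<in> space M. y < \<bar>g x\<bar>}" for y
    using assms by auto
  then show ?thesis by (simp add: rearrangement_def fun_eq_iff)
qed

lemma lorentz_norm_cong:
  assumes "\<And>x. x \<in> space M \<Longrightarrow> \<bar>f x\<bar> = \<bar>g x\<bar>"
  shows "lorentz_norm M p s f = lorentz_norm M p s g"
proof -
  have "rearrangement M f = rearrangement M g" by (rule rearrangement_cong[OF assms])
  then show ?thesis by (simp add: lorentz_norm_def)
qed

lemma rearrangement_antimono: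
  assumes "t \<le> t'" shows "rearrangement M f t' \<le> rearrangement M f t"
  unfolding rearrangement_def
proof (intro Inf_superset_mono subsetI, clarify)
  fix y :: real assume y: "0 \<le> y" "emeasure M {x \<in> space M. y < \<bar>f x\<bar>} \<le> ennreal t"
  then have "emeasure M {x \<in> space M. y < \<bar>f x\<bar>} \<le> ennreal t'"
    using ennreal_leI[OF assms] by (rule_tac order_trans)
  then show "\<exists>ya. ennreal y = ennreal ya \<and> 0 \<le> ya \<and> emeasure M {x \<in> space M. ya < \<bar>f x\<bar>} \<le> ennreal t'"
    using y by auto
qed

lemma measurable_rearrangement [measurable]: "rearrangement M f \<in> borel_measurable borel"
proof (rule borel_measurableI_greater)
  fix y
  \<comment> \<open>Superlevel sets of a monotone function are intervals.\<close>
  have "is_interval {x. y < rearrangement M f x}"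
    unfolding is_interval_1 using rearrangement_antimono by (metis (mono_tags) mem_Collect_eq order_less_le_trans)
  then show "{x \<in> space borel. y < rearrangement M f x} \<in> sets borel"
    using real_interval_borel_measurable by simp
qed

lemma measurable_ennreal_powr [measurable]:
  assumes "0 < r"
  shows "(\<lambda>x. ennreal_powr x r) \<in> borel_measurable borel"
  unfolding ennreal_powr_def by measurable

lemma rearrangement_mono:
  assumes "f \<in> borel_measurable M" "\<And>x. x \<in> space M \<Longrightarrow> \<bar>g x\<bar> \<le> \<bar>f x\<bar>"
  shows "rearrangement M g t \<le> rearrangement M f t"
  unfolding rearrangement_def
proof (intro Inf_superset_mono subsetI, clarify)
  note [measurable] = assms(1)
  fix y :: real assume y: "0 \<le> y" "emeasure M {x \<in> space M. y < \<bar>f x\<bar>} \<le> ennreal t"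
  have "emeasure M {x \<in> space M. y < \<bar>g x\<bar>} \<le> emeasure M {x \<in> space M. y < \<bar>f x\<bar>}"
    by (intro emeasure_mono) (use assms in \<open>auto intro: less_le_trans\<close>)
  then show "\<exists>ya. ennreal y = ennreal ya \<and> 0 \<le> ya \<and> emeasure M {x \<in> space M. ya < \<bar>g x\<bar>} \<le> ennreal t"
    using y by (auto intro: order_trans)
qed

text \<open>The level sets of \<open>F n\<close> increase to those of \<open>f\<close>, so
  continuity of the measure from below passes the bound \<open>t\<close> to the limit.\<close>

lemma rearrangement_SUP:
  fixes F :: "nat \<Rightarrow> 'a \<Rightarrow> real"
  assumes F: "\<And>n. F n \<in> borel_measurable M" and f: "f \<in> borel_measurable M"
    and inc: "\<And>m n x. x \<in> space M \<Longrightarrow> m \<le> n \<Longrightarrow> \<bar>F m x\<bar> \<le> \<bar>F n x\<bar>"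
    and le: "\<And>n x. x \<in> space M \<Longrightarrow> \<bar>F n x\<bar> \<le> \<bar>f x\<bar>"
    and lim: "\<And>x. x \<in> space M \<Longrightarrow> (\<lambda>n. \<bar>F n x\<bar>) \<longlonglongrightarrow> \<bar>f x\<bar>"
  shows "rearrangement M f t = (SUP n. rearrangement M (F n) t)"
proof (rule antisym)
  note [measurable] = F f
  show "(SUP n. rearrangement M (F n) t) \<le> rearrangement M f t"
    by (intro SUP_least rearrangement_mono f le)
  show "rearrangement M f t \<le> (SUP n. rearrangement M (F n) t)"
  \<comment> \<open>Below a finite \<open>z\<close> that exceeds the supremum each
    \<open>F n\<close> has an admissible level, so \<open>z\<close> is admissible for all
    \<open>F n\<close> and hence for \<open>f\<close>.\<close>
  proof (rule dense_ge)
    fix z assume z: "(SUP n. rearrangement M (F n) t) < z"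
    show "rearrangement M f t \<le> z"
    proof (cases z)
      case (real y)
      have "emeasure M {x \<in> space M. y < \<bar>F n x\<bar>} \<le> ennreal t" for n
      proof -
        have "rearrangement M (F n) t < ennreal y"
          using z real by (metis SUP_lessD UNIV_I)
        then obtain w where w: "0 \<le> w" "emeasure M {x \<in> space M. w < \<bar>F n x\<bar>} \<le> ennreal t" "w < y"
          using real by (auto simp: rearrangement_def Inf_less_iff ennreal_less_iff)
        have "emeasure M {x \<in> space M. y < \<bar>F n x\<bar>} \<le> emeasure M {x \<in> space M. w < \<bar>F n x\<bar>}"
          using w by (intro emeasure_mono) auto
        then show ?thesis using w by simp
      qed
      then have "(SUP n. emeasure M {x \<in> space M. y < \<bar>F n x\<bar>}) \<le> ennreal t"
        by (rule SUP_least)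
      also have "(SUP n. emeasure M {x \<in> space M. y < \<bar>F n x\<bar>}) = emeasure M (\<Union>n. {x \<in> space M. y < \<bar>F n x\<bar>})"
        by (intro SUP_emeasure_incseq) (use inc in \<open>auto simp: incseq_def intro: less_le_trans\<close>)
      also have "(\<Union>n. {x \<in> space M. y < \<bar>F n x\<bar>}) = {x \<in> space M. y < \<bar>f x\<bar>}"
      proof (intro set_eqI iffI)
        fix x assume x: "x \<in> {x \<in> space M. y < \<bar>f x\<bar>}"
        then have "\<forall>\<^sub>F n in sequentially. y < \<bar>F n x\<bar>"
          using lim by (auto dest: order_tendstoD(1))
        then show "x \<in> (\<Union>n. {x \<in> space M. y < \<bar>F n x\<bar>})"
          using x by (auto simp: eventually_sequentially)
      qed (use le in \<open>auto intro: less_le_trans\<close>)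
      finally have "rearrangement M f t \<le> ennreal y"
        using real unfolding rearrangement_def by (intro Inf_lower) auto
      then show ?thesis using real by simp
    qed simp
  qed
qed

text \<open>The Fatou property of the norm. Since \<open>C\<close> does not depend on
  \<open>n\<close>, it may be a multiple of the dual norm of the limit \<open>f\<close>
  itself.\<close>

lemma lorentz_norm_le_of_approx:
  fixes F :: "nat \<Rightarrow> 'a \<Rightarrow> real"
  assumes F: "\<And>n. F n \<in> borel_measurable M" and f: "f \<in> borel_measurable M"
    and inc: "\<And>m n x. x \<in> space M \<Longrightarrow> m \<le> n \<Longrightarrow> \<bar>F m x\<bar> \<le> \<bar>F n x\<bar>"
    and le: "\<And>n x. x \<in> space M \<Longrightarrow> \<bar>F n x\<bar> \<le> \<bar>f x\<bar>"
    and lim: "\<And>x. x \<in> space M \<Longrightarrow> (\<lambda>n. \<bar>F n x\<bar>) \<longlonglongrightarrow> \<bar>f x\<bar>"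
    and s: "0 < s" and C: "\<And>n. lorentz_norm M p s (F n) \<le> C"
  shows "lorentz_norm M p s f \<le> C"
proof -
  have R: "rearrangement M f t = (SUP n. rearrangement M (F n) t)" for t
    by (rule rearrangement_SUP) (use assms in auto)
  show ?thesis
  proof (cases "s = \<infinity>")
    case True
    have "ennreal (t powr (1 / p)) * rearrangement M (F n) t \<le> C" if "0 < t" for t n
      using C[of n] that True by (auto simp: lorentz_norm_def SUP_le_iff)
    then show ?thesis using True by (auto simp: lorentz_norm_def SUP_le_iff R SUP_mult_left_ennreal)
  next
    case False
    define r where "r = enn2real s"
    have r: "0 < r" using s False by (cases s) (auto simp: r_def)
    define I where "I G t = ennreal_powr (ennreal (t powr (1 / p)) * rearrangement M G t) r
      * ennreal (1 / t) * indicator {0<..} t" for G t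
    have norm: "lorentz_norm M p s G = ennreal_powr (\<integral>\<^sup>+t. I G t \<partial>lborel) (1 / r)" for G
      using False by (simp add: lorentz_norm_def I_def r_def)
    have "I f t = (SUP n. I (F n) t)" for t
      unfolding I_def R SUP_mult_left_ennreal ennreal_powr_SUP[OF r] SUP_mult_right_ennreal ..
    then have "(\<integral>\<^sup>+t. I f t \<partial>lborel) = (\<integral>\<^sup>+t. (SUP n. I (F n) t) \<partial>lborel)" by simp
    also have "\<dots> = (SUP n. \<integral>\<^sup>+t. I (F n) t \<partial>lborel)"
    proof (rule nn_integral_monotone_convergence_SUP)
      show "incseq (\<lambda>n. I (F n))"
        unfolding I_def
        by (intro incseq_SucI le_funI mult_right_mono ennreal_powr_mono mult_left_mono r
          rearrangement_mono F inc) auto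
      show "I (F n) \<in> borel_measurable lborel" for n
        unfolding I_def using r by measurable
    qed
    also have "ennreal_powr \<dots> (1 / r) = (SUP n. lorentz_norm M p s (F n))"
      unfolding norm using r by (intro ennreal_powr_SUP) auto
    also have "\<dots> \<le> C" using C by (rule SUP_least)
    finally show ?thesis unfolding norm by simp
  qed
qed

section \<open>Step functions\<close>

lemma nn_integral_powr_from_0:
  fixes c :: real
  assumes "0 < r" "0 \<le> c"
  shows "(\<integral>\<^sup>+t. ennreal (t powr (r - 1)) * indicator {0..<c} t \<partial>lborel) = ennreal (c powr r / r)"
proof -
  have "((\<lambda>t. t powr (r - 1)) has_integral (c powr r / r)) {0..c}"
    using has_integral_powr_from_0[of "r - 1" c] assms by simp
  then have "((\<lambda>t. t powr (r - 1) * indicator {0..c} t) has_integral (c powr r / r)) UNIV"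
    by (subst (asm) has_integral_restrict_UNIV[symmetric])
      (simp add: indicator_def of_bool_def if_distrib cong: if_cong)
  then have "(\<integral>\<^sup>+t. ennreal (t powr (r - 1) * indicator {0..c} t) \<partial>lborel) = ennreal (c powr r / r)"
    by (intro nn_integral_has_integral_lborel) auto
  moreover have "(\<integral>\<^sup>+t. ennreal (t powr (r - 1) * indicator {0..c} t) \<partial>lborel)
      = (\<integral>\<^sup>+t. ennreal (t powr (r - 1)) * indicator {0..<c} t \<partial>lborel)"
    by (intro nn_integral_cong_AE AE_I[where N = "{c}"])
      (auto simp: indicator_def split: if_splits)
  ultimately show ?thesis by simp
qed

lemma nn_integral_powr_interval:
  fixes b c :: real
  assumes "0 < r" "0 \<le> b" "b \<le> c"
  shows "(\<integral>\<^sup>+t. ennreal (t powr (r - 1)) * indicator {b..<c} t \<partial>lborel) = ennreal ((c powr r - b powr r) / r)"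
proof -
  have "(\<integral>\<^sup>+t. ennreal (t powr (r - 1)) * indicator {0..<b} t \<partial>lborel)
      + (\<integral>\<^sup>+t. ennreal (t powr (r - 1)) * indicator {b..<c} t \<partial>lborel)
      = (\<integral>\<^sup>+t. ennreal (t powr (r - 1)) * indicator {0..<c} t \<partial>lborel)"
    using assms by (subst nn_integral_add[symmetric]) (auto intro!: nn_integral_cong simp: indicator_def)
  \<comment> \<open>The finite integral up to \<open>b\<close> is cancelled rather than subtracted,
    since subtraction in \<open>ennreal\<close> is truncated.\<close>
  then have "ennreal (b powr r / r)
      + (\<integral>\<^sup>+t. ennreal (t powr (r - 1)) * indicator {b..<c} t \<partial>lborel) = ennreal (c powr r / r)"
    using assms by (simp add: nn_integral_powr_from_0)
  moreover have "ennreal (b powr r / r) + ennreal ((c powr r - b powr r) / r) = ennreal (c powr r / r)"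
    using assms by (subst ennreal_plus[symmetric])
      (auto simp: diff_divide_distrib intro!: divide_right_mono powr_mono2)
  ultimately show ?thesis
    by (metis ennreal_add_left_cancel ennreal_neq_top infinity_ennreal_def)
qed

definition step_fun :: "(nat \<Rightarrow> 'a set) \<Rightarrow> nat \<Rightarrow> (nat \<Rightarrow> real) \<Rightarrow> 'a \<Rightarrow> real" where
  "step_fun A n b x = (\<Sum>k<n. b k * indicator (A k) x)"

text \<open>For disjoint \<open>A\<close> and decreasing values these are the breakpoints of the
  rearrangement of \<open>step_fun\<close>.\<close>

definition cum_measure :: "'a measure \<Rightarrow> (nat \<Rightarrow> 'a set) \<Rightarrow> nat \<Rightarrow> real" where
  "cum_measure M A k = (\<Sum>j<k. measure M (A j))"

lemma step_fun_on:
  assumes "disjoint_family A" "x \<in> A j"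
  shows "step_fun A n b x = (if j < n then b j else 0)"
proof -
  have "indicator (A k) x = (of_bool (k = j) :: real)" for k
    using assms disjoint_family_onD[of A UNIV k j] by (auto simp: indicator_def)
  then show ?thesis by (auto simp: step_fun_def if_distrib cong: if_cong)
qed

lemma step_fun_off: "(\<And>j. j < n \<Longrightarrow> x \<notin> A j) \<Longrightarrow> step_fun A n b x = 0"
  by (simp add: step_fun_def)

lemma cum_measure_0 [simp]: "cum_measure M A 0 = 0"
  by (simp add: cum_measure_def)

lemma cum_measure_Suc: "cum_measure M A (Suc k) = cum_measure M A k + measure M (A k)"
  by (simp add: cum_measure_def)

lemma cum_measure_mono: "j \<le> k \<Longrightarrow> cum_measure M A j \<le> cum_measure M A k"
  unfolding cum_measure_def by (intro sum_mono2) auto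

lemma cum_measure_nonneg [simp]: "0 \<le> cum_measure M A k"
  by (simp add: cum_measure_def sum_nonneg)

locale level_sets =
  fixes M :: "'a measure" and A :: "nat \<Rightarrow> 'a set"
  assumes fmeas: "A k \<in> fmeasurable M"
    and disj: "disjoint_family A"
begin

abbreviation T :: "nat \<Rightarrow> real" where "T \<equiv> cum_measure M A"

lemma sets_A [measurable, simp]: "A k \<in> sets M"
  using fmeas by (simp add: fmeasurable_def)

lemma measurable_step_fun [measurable]: "step_fun A n b \<in> borel_measurable M"
  unfolding step_fun_def by measurable

lemma emeasure_Un_A: "emeasure M (\<Union>j<k. A j) = ennreal (T k)"
proof -
  have "emeasure M (\<Union>j<k. A j) = (\<Sum>j<k. emeasure M (A j))"
    using disj by (intro sum_emeasure[symmetric]) (auto intro: disjoint_family_on_mono)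
  also have "\<dots> = (\<Sum>j<k. ennreal (measure M (A j)))"
    using fmeas by (intro sum.cong emeasure_eq_measure2) auto
  finally show ?thesis by (simp add: cum_measure_def)
qed

text \<open>The function exceeds \<open>b k\<close> only on the first \<open>k\<close> sets, of
  total measure \<open>T k \<le> t\<close>, whereas any nonnegative level below \<open>b k\<close>
  is exceeded on the first \<open>k + 1\<close> sets, of measure greater than
  \<open>t\<close>.\<close>

lemma rearrangement_step_fun:
  assumes b: "\<And>j. j < n \<Longrightarrow> 0 \<le> b j" "\<And>i j. i \<le> j \<Longrightarrow> j < n \<Longrightarrow> b j \<le> b i"
    and k: "k < n" "T k \<le> t" "t < T (Suc k)"
  shows "rearrangement M (step_fun A n b) t = ennreal (b k)"
proof (rule antisym)
  have "{x \<in> space M. b k < \<bar>step_fun A n b x\<bar>} \<subseteq> (\<Union>j<k. A j)"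
  proof clarify
    fix x assume x: "b k < \<bar>step_fun A n b x\<bar>"
    have "0 \<le> b k" using b k by simp
    then obtain j where j: "j < n" "x \<in> A j"
      using x step_fun_off[of n x A b] by force
    then have "b k < b j" using x b step_fun_on[OF disj, of x j n b] by simp
    then have "j < k" using b(2)[of k j] j by force
    then show "x \<in> (\<Union>j<k. A j)" using j by auto
  qed
  then have "emeasure M {x \<in> space M. b k < \<bar>step_fun A n b x\<bar>} \<le> emeasure M (\<Union>j<k. A j)"
    by (rule emeasure_mono) simp
  also have "\<dots> \<le> ennreal t"
    unfolding emeasure_Un_A using k by (intro ennreal_leI)
  finally show "rearrangement M (step_fun A n b) t \<le> ennreal (b k)"
    unfolding rearrangement_def using b(1)[OF k(1)] by (intro Inf_lower) auto
  show "ennreal (b k) \<le> rearrangement M (step_fun A n b) t"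
    unfolding rearrangement_def
  proof (intro Inf_greatest, clarify)
    fix y :: real assume y: "0 \<le> y" "emeasure M {x \<in> space M. y < \<bar>step_fun A n b x\<bar>} \<le> ennreal t"
    have "b k \<le> y"
    proof (rule ccontr)
      assume yb: "\<not> b k \<le> y"
      have "(\<Union>j<Suc k. A j) \<subseteq> {x \<in> space M. y < \<bar>step_fun A n b x\<bar>}"
      proof clarify
        fix x j assume j: "j < Suc k" "x \<in> A j"
        then have "b k \<le> b j" "step_fun A n b x = b j"
          using b k step_fun_on[OF disj, of x j n b] by auto
        then show "x \<in> space M \<and> y < \<bar>step_fun A n b x\<bar>"
          using yb j sets.sets_into_space[OF sets_A] by auto
      qed
      then have "emeasure M (\<Union>j<Suc k. A j) \<le> emeasure M {x \<in> space M. y < \<bar>step_fun A n b x\<bar>}"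
        by (rule emeasure_mono) measurable
      then have "ennreal (T (Suc k)) \<le> ennreal t"
        unfolding emeasure_Un_A using y(2) by (rule order_trans)
      then show False using k cum_measure_nonneg[of M A k] by simp
    qed
    then show "ennreal (b k) \<le> ennreal y" by (rule ennreal_leI)
  qed
qed

lemma rearrangement_step_fun_beyond:
  assumes "T n \<le> t"
  shows "rearrangement M (step_fun A n b) t = 0"
proof -
  have "{x \<in> space M. 0 < \<bar>step_fun A n b x\<bar>} \<subseteq> (\<Union>j<n. A j)"
  proof clarify
    fix x assume "0 < \<bar>step_fun A n b x\<bar>"
    then have "\<exists>j<n. x \<in> A j" using step_fun_off[of n x A b] by auto
    then show "x \<in> (\<Union>j<n. A j)" by auto
  qed
  then have "emeasure M {x \<in> space M. 0 < \<bar>step_fun A n b x\<bar>} \<le> emeasure M (\<Union>j<n. A j)"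
    by (rule emeasure_mono) simp
  also have "\<dots> \<le> ennreal t"
    unfolding emeasure_Un_A using assms by (rule ennreal_leI)
  finally have "rearrangement M (step_fun A n b) t \<le> ennreal 0"
    unfolding rearrangement_def by (intro Inf_lower) force
  then show ?thesis by simp
qed

lemma T_interval:
  assumes "0 \<le> t" "t < T n"
  obtains k where "k < n" "T k \<le> t" "t < T (Suc k)"
  using assms(2)
proof (induction n arbitrary: thesis)
  case (Suc n)
  show ?case
  proof (cases "t < T n")
    case True
    show ?thesis by (rule Suc.IH[OF _ True]) (rule Suc.prems(1)[OF less_SucI])
  next
    case False
    then show ?thesis using Suc.prems(1)[of n] Suc.prems(2) by simp
  qed
qed (use assms in simp)

text \<open>On \<open>{T k..<T (Suc k)}\<close> the integrand is
  \<open>b k powr r * t powr (r / p - 1)\<close>, whose integral is explicit.\<close>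

lemma lorentz_norm_step_fun:
  assumes b: "\<And>j. j < n \<Longrightarrow> 0 \<le> b j" "\<And>i j. i \<le> j \<Longrightarrow> j < n \<Longrightarrow> b j \<le> b i"
    and p: "0 < p" and r: "0 < r"
  shows "lorentz_norm M p (ennreal r) (step_fun A n b) =
    ennreal ((p / r * (\<Sum>k<n. b k powr r * (T (Suc k) powr (r / p) - T k powr (r / p)))) powr (1 / r))"
proof -
  have incr: "0 \<le> T (Suc k) powr (r / p) - T k powr (r / p)" for k
    using p r by (simp add: powr_mono2 cum_measure_mono)
  have "ennreal_powr (ennreal (t powr (1 / p)) * rearrangement M (step_fun A n b) t) r * ennreal (1 / t)
      * indicator {0<..} t
    = (\<Sum>k<n. ennreal (b k powr r) * (ennreal (t powr (r / p - 1)) * indicator {T k..<T (Suc k)} t))" for t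
  proof (cases "0 < t")
    case True
    show ?thesis
    proof (cases "t < T n")
      case tn: True
      then obtain k where k: "k < n" "T k \<le> t" "t < T (Suc k)"
        using T_interval[of t n] True by auto
      have eq: "ennreal (b j powr r) * (ennreal (t powr (r / p - 1)) * indicator {T j..<T (Suc j)} t)
          = (if j = k then ennreal (b k powr r) * ennreal (t powr (r / p - 1)) else 0)" for j
      proof (cases j k rule: linorder_cases)
        case less
        then show ?thesis using k cum_measure_mono[of "Suc j" k M A] by simp
      next
        case greater
        then show ?thesis using k cum_measure_mono[of "Suc k" j M A] by simp
      qed (use k in simp)
      have "(\<Sum>j<n. ennreal (b j powr r) * (ennreal (t powr (r / p - 1)) * indicator {T j..<T (Suc j)} t))
          = ennreal (b k powr r) * ennreal (t powr (r / p - 1))"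
        unfolding eq using k by (simp add: sum.delta)
      moreover have "ennreal_powr (ennreal (t powr (1 / p)) * ennreal (b k)) r * ennreal (1 / t)
          = ennreal ((t powr (1 / p) * b k) powr r * (1 / t))"
        using True b k by (simp add: ennreal_mult[symmetric] ennreal_powr_ennreal)
      moreover have "(t powr (1 / p) * b k) powr r * (1 / t) = b k powr r * t powr (r / p - 1)"
        using True b k by (simp add: powr_mult powr_powr powr_diff)
      ultimately show ?thesis
        using True rearrangement_step_fun[of n b k t] b k by (simp add: ennreal_mult)
    next
      case False
      have "indicator {T k..<T (Suc k)} t = (0 :: ennreal)" if "k < n" for k
        using that False cum_measure_mono[of "Suc k" n M A] by auto
      moreover have "rearrangement M (step_fun A n b) t = 0"
        using False rearrangement_step_fun_beyond[of n t b] by simp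
      ultimately show ?thesis
        using r by (simp add: ennreal_powr_def)
    qed
  next
    case False
    \<comment> \<open>All intervals lie to the right of 0, and at \<open>t = 0\<close> the
      convention \<open>0 powr _ = 0\<close> makes the summand vanish.\<close>
    have "ennreal (t powr (r / p - 1)) * indicator {T k..<T (Suc k)} t = 0" for k
    proof (cases "t = 0")
      case False
      then have "t < T k" using \<open>\<not> 0 < t\<close> cum_measure_nonneg[of M A k] by linarith
      then show ?thesis by simp
    qed simp
    then show ?thesis using False by simp
  qed
  then have "(\<integral>\<^sup>+t\<in>{0<..}. ennreal_powr (ennreal (t powr (1 / p)) * rearrangement M (step_fun A n b) t) r
      * ennreal (1 / t) \<partial>lborel)
    = (\<integral>\<^sup>+t. (\<Sum>k<n. ennreal (b k powr r) * (ennreal (t powr (r / p - 1)) * indicator {T k..<T (Suc k)} t)) \<partial>lborel)"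
    by simp
  also have "\<dots> = (\<Sum>k<n. ennreal (b k powr r) * ennreal ((T (Suc k) powr (r / p) - T k powr (r / p)) / (r / p)))"
    using p r by (simp add: nn_integral_sum nn_integral_cmult nn_integral_powr_interval cum_measure_mono)
  also have "\<dots> = (\<Sum>k<n. ennreal (b k powr r * ((T (Suc k) powr (r / p) - T k powr (r / p)) / (r / p))))"
    using p r by (intro sum.cong refl ennreal_mult[symmetric] divide_nonneg_pos incr) auto
  also have "\<dots> = ennreal (\<Sum>k<n. b k powr r * ((T (Suc k) powr (r / p) - T k powr (r / p)) / (r / p)))"
    using p r by (intro sum_ennreal mult_nonneg_nonneg divide_nonneg_pos incr) auto
  also have "(\<Sum>k<n. b k powr r * ((T (Suc k) powr (r / p) - T k powr (r / p)) / (r / p)))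
      = p / r * (\<Sum>k<n. b k powr r * (T (Suc k) powr (r / p) - T k powr (r / p)))"
    unfolding sum_distrib_left by (intro sum.cong refl) simp
  finally have "(\<integral>\<^sup>+t\<in>{0<..}. ennreal_powr (ennreal (t powr (1 / p)) * rearrangement M (step_fun A n b) t) r
      * ennreal (1 / t) \<partial>lborel)
    = ennreal (p / r * (\<Sum>k<n. b k powr r * (T (Suc k) powr (r / p) - T k powr (r / p))))" .
  moreover have "0 \<le> p / r * (\<Sum>k<n. b k powr r * (T (Suc k) powr (r / p) - T k powr (r / p)))"
    using p r by (intro mult_nonneg_nonneg sum_nonneg incr) auto
  ultimately show ?thesis
    using r by (simp add: lorentz_norm_def ennreal_powr_ennreal)
qed

end

section \<open>Lower bounds for the dual norm from step test functions\<close>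

context level_sets
begin

text \<open>Giving the step function the sign of \<open>f\<close> turns the product into
  \<open>\<bar>f\<bar>\<close> times the step function and leaves the norm unchanged. The bound
  \<open>c\<close> guarantees integrability, without which the Bochner integral would default to
  0.\<close>

lemma lorentz_dual_norm_ge:
  assumes f [measurable]: "f \<in> borel_measurable M"
    and v: "\<And>k x. k < n \<Longrightarrow> x \<in> A k \<Longrightarrow> v k \<le> \<bar>f x\<bar>"
    and bounded: "\<And>k x. k < n \<Longrightarrow> x \<in> A k \<Longrightarrow> \<bar>f x\<bar> \<le> c"
    and b: "\<And>k. k < n \<Longrightarrow> 0 \<le> b k"
    and norm: "lorentz_norm M (conj_exponent p) (conj_exponent_ext s) (step_fun A n b) = 1"
  shows "ennreal (\<Sum>k<n. v k * b k * measure M (A k)) \<le> lorentz_dual_norm M p s f"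
proof -
  define g where "g x = (if 0 \<le> f x then step_fun A n b x else - step_fun A n b x)" for x
  have [measurable]: "g \<in> borel_measurable M" unfolding g_def by measurable
  have int: "integrable M (\<lambda>x. \<bar>f x\<bar> * indicator (A k) x)" if "k < n" for k
  proof (rule Bochner_Integration.integrable_bound)
    show "integrable M (\<lambda>x. c * indicator (A k) x)"
      using fmeas[of k] by (auto simp: fmeasurable_def)
    show "AE x in M. norm (\<bar>f x\<bar> * indicator (A k) x) \<le> norm (c * indicator (A k) x)"
      using bounded[OF that] by (intro AE_I2) (auto simp: indicator_def intro: order_trans[OF _ abs_ge_self])
  qed measurable
  have "(\<Sum>k<n. v k * b k * measure M (A k)) \<le> (\<Sum>k<n. b k * (\<integral>x. \<bar>f x\<bar> * indicator (A k) x \<partial>M))"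
  proof (rule sum_mono)
    fix k assume "k \<in> {..<n}"
    then have k: "k < n" by simp
    have "v k * measure M (A k) = (\<integral>x. v k * indicator (A k) x \<partial>M)"
      using fmeas[of k] by (simp add: fmeasurable_def)
    also have "\<dots> \<le> (\<integral>x. \<bar>f x\<bar> * indicator (A k) x \<partial>M)"
    proof (rule integral_mono[OF _ int[OF k]])
      show "integrable M (\<lambda>x. v k * indicator (A k) x)"
        using fmeas[of k] by (auto simp: fmeasurable_def)
      show "v k * indicator (A k) x \<le> \<bar>f x\<bar> * indicator (A k) x" for x
        using v[OF k] by (auto simp: indicator_def)
    qed
    finally have "b k * (v k * measure M (A k)) \<le> b k * (\<integral>x. \<bar>f x\<bar> * indicator (A k) x \<partial>M)"
      using b[OF k] by (rule mult_left_mono)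
    then show "v k * b k * measure M (A k) \<le> b k * (\<integral>x. \<bar>f x\<bar> * indicator (A k) x \<partial>M)"
      by (simp add: ac_simps)
  qed
  also have "\<dots> = (\<integral>x. (\<Sum>k<n. b k * (\<bar>f x\<bar> * indicator (A k) x)) \<partial>M)"
    using int by (subst Bochner_Integration.integral_sum) auto
  also have "\<dots> = (\<integral>x. f x * g x \<partial>M)"
  proof (rule Bochner_Integration.integral_cong[OF refl])
    fix x
    have "f x * g x = \<bar>f x\<bar> * step_fun A n b x" by (simp add: g_def)
    also have "\<dots> = (\<Sum>k<n. b k * (\<bar>f x\<bar> * indicator (A k) x))"
      unfolding step_fun_def sum_distrib_left by (intro sum.cong refl) (simp only: ac_simps)
    finally show "(\<Sum>k<n. b k * (\<bar>f x\<bar> * indicator (A k) x)) = f x * g x" ..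
  qed
  finally have "ennreal (\<Sum>k<n. v k * b k * measure M (A k)) \<le> ennreal (\<integral>x. f x * g x \<partial>M)"
    by (rule ennreal_leI)
  moreover have "lorentz_norm M (conj_exponent p) (conj_exponent_ext s) g = 1"
    unfolding norm[symmetric] by (rule lorentz_norm_cong) (simp add: g_def)
  ultimately show ?thesis
    unfolding lorentz_dual_norm_def lorentz_space_def by (intro Sup_upper2) auto
qed

text \<open>The values \<open>v\<close> only bound \<open>\<bar>f\<bar>\<close> from below, so that
  the right-hand side carries the dual norm of \<open>f\<close> and stays fixed when step functions
  approximate \<open>f\<close>.\<close>

lemma lorentz_norm_step_fun_le_dual:
  fixes p s :: real
  assumes p: "1 < p" "p < s" and f [measurable]: "f \<in> borel_measurable M"
    and v: "\<And>k. 0 \<le> v k" "\<And>k. v (Suc k) \<le> v k" "v n = 0"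
    and vf: "\<And>k x. k < n \<Longrightarrow> x \<in> A k \<Longrightarrow> v k \<le> \<bar>f x\<bar>"
    and bounded: "\<And>k x. k < n \<Longrightarrow> x \<in> A k \<Longrightarrow> \<bar>f x\<bar> \<le> c"
  shows "lorentz_norm M p (ennreal s) (step_fun A n v)
    \<le> ennreal (lorentz_const p (ennreal s)) * lorentz_dual_norm M p (ennreal s) f"
proof -
  define p' s' where "p' = p / (p - 1)" and "s' = s / (s - 1)"
  have p's': "0 < p'" "0 < s'" "1 < s'" using p by (auto simp: p'_def s'_def)
  have conj: "conj_exponent p = p'" "conj_exponent_ext (ennreal s) = ennreal s'"
    using p by (auto simp: p'_def s'_def conj_exponent_def conj_exponent_ext_def)
  have const: "lorentz_const p (ennreal s) = (p / s) powr (1 / s) * (p' / s') powr (1 / s')"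
    using p p's' by (simp add: lorentz_const_def conj)
  have decr: "v j \<le> v i" if "i \<le> j" for i j
    using that v(2) by (rule lift_Suc_antimono_le[rotated])
  obtain h where h: "\<And>k. k \<le> n \<Longrightarrow> 0 \<le> h k" "\<And>i j. i \<le> j \<Longrightarrow> j \<le> n \<Longrightarrow> h j \<le> h i"
    "\<And>k. k < n \<Longrightarrow> v k * T (Suc k) powr ((s - p) / (p * (s - 1))) \<le> h k"
    and ineq: "(\<Sum>k<n. v k powr s * (T (Suc k) powr (s / p) - T k powr (s / p)))
      + (s - 1) * (\<Sum>k<n. h k powr s * (T (Suc k) powr (s' / p') - T k powr (s' / p')))
      \<le> s * (\<Sum>k<n. v k * h k powr (s - 1) * (T (Suc k) - T k))"
    using step_inequality[OF p p'_def s'_def, of T v n] v by (auto simp: cum_measure_mono)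
  define B where "B = (\<Sum>k<n. v k powr s * (T (Suc k) powr (s / p) - T k powr (s / p)))"
  define D where "D = (\<Sum>k<n. h k powr s * (T (Suc k) powr (s' / p') - T k powr (s' / p')))"
  define E where "E = (\<Sum>k<n. v k * h k powr (s - 1) * (T (Suc k) - T k))"
  have incr: "0 \<le> T (Suc k) powr q - T k powr q" if "0 < q" for q k
    using that by (simp add: powr_mono2 cum_measure_mono)
  have B0: "0 \<le> B" unfolding B_def using p by (intro sum_nonneg mult_nonneg_nonneg incr) auto
  have D0: "0 \<le> D" unfolding D_def using p's' by (intro sum_nonneg mult_nonneg_nonneg incr) auto
  have norm: "lorentz_norm M p (ennreal s) (step_fun A n v) = ennreal ((p / s * B) powr (1 / s))"
    unfolding B_def using p v decr by (intro lorentz_norm_step_fun) auto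
  show ?thesis
  proof (cases "B = 0")
    case True
    then show ?thesis by (simp add: norm)
  next
    case False
    \<comment> \<open>A nonzero summand of \<open>B\<close> comes from a step of positive value and
      positive length; there the lower bound makes \<open>h\<close> positive, so
      \<open>D > 0\<close> and the test function can be normalized.\<close>
    then obtain k where k: "k < n" "v k powr s * (T (Suc k) powr (s / p) - T k powr (s / p)) \<noteq> 0"
      unfolding B_def by (meson lessThan_iff sum.not_neutral_contains_not_neutral)
    then have "0 < v k" using v(1)[of k] by (cases "v k = 0") auto
    have "T k < T (Suc k)"
      using k cum_measure_mono[of k "Suc k" M A] by (cases "T k = T (Suc k)") auto
    then have Tk: "0 < T (Suc k)" using cum_measure_nonneg[of M A k] by linarith
    have "0 < v k * T (Suc k) powr ((s - p) / (p * (s - 1)))"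
      using \<open>0 < v k\<close> Tk by simp
    also have "\<dots> \<le> h k" using k by (intro h(3))
    finally have "0 < h k" .
    have "T k powr (s' / p') < T (Suc k) powr (s' / p')"
      using \<open>T k < T (Suc k)\<close> p's' by (intro powr_less_mono2) auto
    with \<open>0 < h k\<close> have "0 < h k powr s * (T (Suc k) powr (s' / p') - T k powr (s' / p'))"
      by simp
    also have "\<dots> \<le> D"
      unfolding D_def using p's' k by (intro member_le_sum mult_nonneg_nonneg incr) auto
    finally have D: "0 < D" .
    \<comment> \<open>The norm of the unnormalized test function \<open>h powr (s - 1)\<close>,
      because \<open>(s - 1) * s' = s\<close>.\<close>
    define K where "K = (p' / s' * D) powr (1 / s')"
    have K: "0 < K" "K powr s' = p' / s' * D"
      using D p's' by (auto simp: K_def powr_powr)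
    have "lorentz_norm M p' (ennreal s') (step_fun A n (\<lambda>k. h k powr (s - 1) / K))
        = ennreal ((p' / s' * (\<Sum>k<n. (h k powr (s - 1) / K) powr s'
          * (T (Suc k) powr (s' / p') - T k powr (s' / p')))) powr (1 / s'))"
      using h p p's' K by (intro lorentz_norm_step_fun) (auto intro!: divide_right_mono powr_mono2)
    also have "(\<Sum>k<n. (h k powr (s - 1) / K) powr s' * (T (Suc k) powr (s' / p') - T k powr (s' / p')))
        = D / K powr s'"
    proof -
      have "(h k powr (s - 1) / K) powr s' = h k powr s / K powr s'" if "k < n" for k
        using h(1)[of k] that p K by (simp add: powr_divide powr_powr s'_def)
      then show ?thesis by (simp add: D_def sum_divide_distrib)
    qed
    also have "p' / s' * (D / K powr s') = 1"
      using K D p's' by simp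
    finally have "lorentz_norm M (conj_exponent p) (conj_exponent_ext (ennreal s))
        (step_fun A n (\<lambda>k. h k powr (s - 1) / K)) = 1"
      by (simp add: conj)
    then have "ennreal (\<Sum>k<n. v k * (h k powr (s - 1) / K) * measure M (A k))
        \<le> lorentz_dual_norm M p (ennreal s) f"
      using K vf bounded by (intro lorentz_dual_norm_ge[where c = c]) auto
    also have "(\<Sum>k<n. v k * (h k powr (s - 1) / K) * measure M (A k)) = E / K"
      by (simp add: E_def sum_divide_distrib cum_measure_Suc)
    finally have dual: "ennreal (E / K) \<le> lorentz_dual_norm M p (ennreal s) f" .
    \<comment> \<open>Young's inequality produces the left side of \<open>ineq\<close> divided by
      \<open>s\<close>, as \<open>s / s' = s - 1\<close>.\<close>
    have "B powr (1 / s) * D powr (1 / s') \<le> (B powr (1 / s)) powr s / s + (D powr (1 / s')) powr s' / s'"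
      using p p's' by (intro Youngs_inequality) (auto simp: s'_def field_simps)
    also have "\<dots> = B / s + D / s'" using B0 D p p's' by (simp add: powr_powr)
    also have "\<dots> = (B + (s - 1) * D) / s" using p by (simp add: s'_def field_simps)
    also have "\<dots> \<le> E"
      using ineq p by (simp add: B_def D_def E_def divide_le_eq mult.commute)
    finally have E: "B powr (1 / s) * D powr (1 / s') \<le> E" .
    have "(p / s * B) powr (1 / s) = (p / s) powr (1 / s) * B powr (1 / s)"
      using p B0 by (simp add: powr_mult powr_divide)
    also have "B powr (1 / s) \<le> E / D powr (1 / s')"
      using E D by (simp add: pos_le_divide_eq)
    also have "(p / s) powr (1 / s) * (E / D powr (1 / s')) = lorentz_const p (ennreal s) * (E / K)"
    proof -
      \<comment> \<open>Passing from \<open>D powr (1 / s')\<close> to \<open>K\<close> brings in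
        exactly the second factor of \<open>lorentz_const\<close>.\<close>
      have "K = (p' / s') powr (1 / s') * D powr (1 / s')"
        unfolding K_def by (rule powr_mult)
      then show ?thesis using p's' by (simp add: const)
    qed
    finally have "(p / s * B) powr (1 / s) \<le> lorentz_const p (ennreal s) * (E / K)"
      by (simp add: mult_left_mono)
    then have "ennreal ((p / s * B) powr (1 / s)) \<le> ennreal (lorentz_const p (ennreal s)) * ennreal (E / K)"
      by (subst ennreal_mult''[symmetric]) 
        (use K E order_trans[OF _ E] in \<open>auto simp: ennreal_leI const\<close>)
    also have "\<dots> \<le> ennreal (lorentz_const p (ennreal s)) * lorentz_dual_norm M p (ennreal s) f"
      using dual by (rule mult_left_mono) simp
    finally show ?thesis by (simp add: norm)
  qed
qed

text \<open>For \<open>t\<close> in step \<open>k\<close> the test function is the normalized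
  indicator of the first \<open>k + 1\<close> sets, where \<open>\<bar>f\<bar> \<ge> v k\<close>. Up
  to sign changes, its pairing with \<open>f\<close> is at least
  \<open>v k * T (Suc k) powr (1 / p) / p'\<close>.\<close>

lemma lorentz_norm_top_step_fun_le_dual:
  fixes p :: real
  assumes p: "1 < p" and f [measurable]: "f \<in> borel_measurable M"
    and v: "\<And>k. 0 \<le> v k" "\<And>k. v (Suc k) \<le> v k"
    and vf: "\<And>k x. k < n \<Longrightarrow> x \<in> A k \<Longrightarrow> v k \<le> \<bar>f x\<bar>"
    and bounded: "\<And>k x. k < n \<Longrightarrow> x \<in> A k \<Longrightarrow> \<bar>f x\<bar> \<le> c"
  shows "lorentz_norm M p \<infinity> (step_fun A n v)
    \<le> ennreal (lorentz_const p \<infinity>) * lorentz_dual_norm M p \<infinity> f"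
proof -
  define p' where "p' = p / (p - 1)"
  have p': "0 < p'" "1 / p = 1 - 1 / p'" using p by (auto simp: p'_def field_simps)
  have conj: "conj_exponent p = p'" "conj_exponent_ext \<infinity> = 1"
    using p by (auto simp: p'_def conj_exponent_def conj_exponent_ext_def)
  have const: "lorentz_const p \<infinity> = p'"
    using p' conj by (simp add: lorentz_const_def)
  have decr: "v j \<le> v i" if "i \<le> j" for i j
    using that v(2) by (rule lift_Suc_antimono_le[rotated])
  have "ennreal (t powr (1 / p)) * rearrangement M (step_fun A n v) t
      \<le> ennreal p' * lorentz_dual_norm M p \<infinity> f" if t: "0 < t" for t
  proof (cases "t < T n")
    case True
    then obtain k where k: "k < n" "T k \<le> t" "t < T (Suc k)"
      using T_interval[of t n] t by auto
    \<comment> \<open>The norm of that indicator for the exponents \<open>p'\<close> and 1.\<close>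
    define K where "K = p' * T (Suc k) powr (1 / p')"
    have Tk: "0 < T (Suc k)" using k t by simp
    have K: "0 < K" using Tk p' by (simp add: K_def)
    have "lorentz_norm M p' (ennreal 1) (step_fun A (Suc k) (\<lambda>_. 1 / K))
        = ennreal ((p' / 1 * (\<Sum>j<Suc k. (1 / K) powr 1 * (T (Suc j) powr (1 / p') - T j powr (1 / p')))) powr (1 / 1))"
      using p' K by (intro lorentz_norm_step_fun) auto
    also have "(\<Sum>j<Suc k. (1 / K) powr 1 * (T (Suc j) powr (1 / p') - T j powr (1 / p')))
        = 1 / K * T (Suc k) powr (1 / p')"
    proof -
      have "(\<Sum>j<Suc k. T (Suc j) powr (1 / p') - T j powr (1 / p')) = T (Suc k) powr (1 / p')"
        using sum_lessThan_telescope[of "\<lambda>j. T j powr (1 / p')" "Suc k"] by simp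
      then show ?thesis using K unfolding sum_distrib_left[symmetric] by (simp only:) simp
    qed
    also have "p' / 1 * (1 / K * T (Suc k) powr (1 / p')) = 1"
      using p' Tk by (simp add: K_def)
    finally have "lorentz_norm M (conj_exponent p) (conj_exponent_ext \<infinity>) (step_fun A (Suc k) (\<lambda>_. 1 / K)) = 1"
      unfolding conj by simp
    moreover have "v j \<le> \<bar>f x\<bar>" "\<bar>f x\<bar> \<le> c" if "j < Suc k" "x \<in> A j" for j x
      using that k vf[of j x] bounded[of j x] by simp_all
    ultimately have dual: "ennreal (\<Sum>j<Suc k. v j * (1 / K) * measure M (A j)) \<le> lorentz_dual_norm M p \<infinity> f"
      using K by (intro lorentz_dual_norm_ge[where c = c] f) auto
    have "t powr (1 / p) * v k \<le> T (Suc k) powr (1 / p) * v k"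
      using k t p v by (intro mult_right_mono powr_mono2) auto
    also have "T (Suc k) powr (1 / p) * v k = p' * (v k * (1 / K) * T (Suc k))"
      unfolding p'(2) using p' Tk by (simp add: K_def powr_diff)
    also have "v k * (1 / K) * T (Suc k) = (\<Sum>j<Suc k. v k * (1 / K) * measure M (A j))"
      by (simp only: cum_measure_def sum_distrib_left)
    also have "\<dots> \<le> (\<Sum>j<Suc k. v j * (1 / K) * measure M (A j))"
      using K decr by (intro sum_mono mult_right_mono) auto
    finally have "t powr (1 / p) * v k \<le> p' * (\<Sum>j<Suc k. v j * (1 / K) * measure M (A j))"
      using p' by (simp add: mult_left_mono)
    then have "ennreal (t powr (1 / p) * v k) \<le> ennreal p' * ennreal (\<Sum>j<Suc k. v j * (1 / K) * measure M (A j))"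
      using p' by (subst ennreal_mult'[symmetric]) (auto intro!: ennreal_leI simp del: sum.lessThan_Suc)
    also have "\<dots> \<le> ennreal p' * lorentz_dual_norm M p \<infinity> f"
      using dual by (rule mult_left_mono) simp
    finally show ?thesis
      using rearrangement_step_fun[of n v k t] v decr k by (simp add: ennreal_mult'')
  next
    case False
    then show ?thesis by (simp add: rearrangement_step_fun_beyond)
  qed
  then show ?thesis unfolding const by (auto simp: lorentz_norm_def SUP_le_iff)
qed

end

section \<open>Dyadic approximation\<close>

text \<open>The index is subtracted in the integers so that levels with \<open>k > n 2\<^sup>n\<close> are empty and the family is
  disjoint; the truncated subtraction in \<open>dyadic_value\<close> makes the values decrease to \<open>0\<close>.\<close>

definition dyadic_level :: "'a set \<Rightarrow> ('a \<Rightarrow> real) \<Rightarrow> nat \<Rightarrow> nat \<Rightarrow> 'a set" where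
  "dyadic_level S f n k = {x \<in> S. \<bar>f x\<bar> \<le> real n \<and> \<lfloor>2 ^ n * \<bar>f x\<bar>\<rfloor> = int (n * 2 ^ n) - int k}"

definition dyadic_value :: "nat \<Rightarrow> nat \<Rightarrow> real" where
  "dyadic_value n k = real (n * 2 ^ n - k) / 2 ^ n"

text \<open>The floor value \<open>l\<close> belongs to the index \<open>n * 2 ^ n - l\<close>. For
  \<open>l = 0\<close> this index falls just outside the sum, in accordance with the value
  0.\<close>

lemma step_fun_dyadic:
  "step_fun (dyadic_level S f n) (n * 2 ^ n) (dyadic_value n) x =
    (if x \<in> S \<and> \<bar>f x\<bar> \<le> real n then real_of_int \<lfloor>2 ^ n * \<bar>f x\<bar>\<rfloor> / 2 ^ n else 0)"
proof (cases "x \<in> S \<and> \<bar>f x\<bar> \<le> real n")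
  case True
  define l where "l = nat \<lfloor>2 ^ n * \<bar>f x\<bar>\<rfloor>"
  have l: "\<lfloor>2 ^ n * \<bar>f x\<bar>\<rfloor> = int l" by (simp add: l_def)
  have "2 ^ n * \<bar>f x\<bar> \<le> 2 ^ n * real n" using True by (intro mult_left_mono) auto
  then have "\<lfloor>2 ^ n * \<bar>f x\<bar>\<rfloor> \<le> \<lfloor>real (n * 2 ^ n)\<rfloor>"
    by (intro floor_mono) (simp add: mult.commute)
  then have "int l \<le> int (n * 2 ^ n)" unfolding l floor_of_nat .
  then have ln: "l \<le> n * 2 ^ n" by linarith
  have "disjoint_family (dyadic_level S f n)"
    by (auto simp: disjoint_family_on_def dyadic_level_def)
  moreover have "x \<in> dyadic_level S f n (n * 2 ^ n - l)"
    using True ln by (simp add: dyadic_level_def l of_nat_diff)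
  ultimately have "step_fun (dyadic_level S f n) (n * 2 ^ n) (dyadic_value n) x
      = (if n * 2 ^ n - l < n * 2 ^ n then dyadic_value n (n * 2 ^ n - l) else 0)"
    by (rule step_fun_on)
  also have "\<dots> = real l / 2 ^ n"
    using ln by (auto simp: dyadic_value_def)
  finally show ?thesis using True l by simp
next
  case False
  then show ?thesis by (auto intro!: step_fun_off simp: dyadic_level_def)
qed

text \<open>The left side times \<open>2 ^ n\<close> is an integer not exceeding
  \<open>2 ^ n * y\<close>.\<close>

lemma dyadic_floor_mono:
  fixes y :: real
  assumes "m \<le> n"
  shows "real_of_int \<lfloor>2 ^ m * y\<rfloor> / 2 ^ m \<le> real_of_int \<lfloor>2 ^ n * y\<rfloor> / 2 ^ n"
proof -
  have n: "(2::real) ^ n = 2 ^ (n - m) * 2 ^ m" using assms by (simp add: power_add[symmetric])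
  have "2 ^ (n - m) * real_of_int \<lfloor>2 ^ m * y\<rfloor> \<le> 2 ^ (n - m) * (2 ^ m * y)"
    by (intro mult_left_mono) auto
  then have "real_of_int (2 ^ (n - m) * \<lfloor>2 ^ m * y\<rfloor>) \<le> 2 ^ n * y"
    by (simp add: n mult.assoc)
  then have "2 ^ (n - m) * \<lfloor>2 ^ m * y\<rfloor> \<le> \<lfloor>2 ^ n * y\<rfloor>" by (simp only: le_floor_iff)
  then have "real_of_int (2 ^ (n - m) * \<lfloor>2 ^ m * y\<rfloor>) \<le> real_of_int \<lfloor>2 ^ n * y\<rfloor>"
    by (simp only: of_int_le_iff)
  then have "2 ^ (n - m) * real_of_int \<lfloor>2 ^ m * y\<rfloor> / 2 ^ n \<le> real_of_int \<lfloor>2 ^ n * y\<rfloor> / 2 ^ n"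
    by (intro divide_right_mono) auto
  then show ?thesis by (simp add: n)
qed

lemma dyadic_floor_tendsto:
  fixes y :: real
  shows "(\<lambda>n. real_of_int \<lfloor>2 ^ n * y\<rfloor> / 2 ^ n) \<longlonglongrightarrow> y"
proof (rule tendsto_sandwich)
  have "real_of_int \<lfloor>2 ^ n * y\<rfloor> / 2 ^ n \<le> y" for n :: nat
    by (simp add: divide_le_eq mult.commute)
  then show "\<forall>\<^sub>F n in sequentially. real_of_int \<lfloor>2 ^ n * y\<rfloor> / 2 ^ n \<le> y" by simp
  have "y - (1 / 2) ^ n \<le> real_of_int \<lfloor>2 ^ n * y\<rfloor> / 2 ^ n" for n :: nat
  proof -
    have "2 ^ n * y - 1 \<le> real_of_int \<lfloor>2 ^ n * y\<rfloor>" by linarith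
    then have "(2 ^ n * y - 1) / 2 ^ n \<le> real_of_int \<lfloor>2 ^ n * y\<rfloor> / 2 ^ n"
      by (intro divide_right_mono) auto
    then show ?thesis by (simp add: diff_divide_distrib power_divide)
  qed
  then show "\<forall>\<^sub>F n in sequentially. y - (1 / 2) ^ n \<le> real_of_int \<lfloor>2 ^ n * y\<rfloor> / 2 ^ n" by simp
  show "(\<lambda>n. y - (1 / 2) ^ n) \<longlonglongrightarrow> y"
    using tendsto_diff[OF tendsto_const[of y] LIMSEQ_realpow_zero[of "1/2"]] by simp
qed simp

text \<open>Restriction to sets \<open>S n\<close> of finite measure that exhaust the space,
  truncation at height \<open>n\<close> and dyadic rounding give step functions that increase to
  \<open>\<bar>f\<bar>\<close>; the bounds for step functions then pass to the limit.\<close>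

theorem lorentz_norm_le_dual_norm:
  fixes M :: "'a measure"
  assumes "1 < p" "ennreal p < s" "sigma_finite_measure M" and f [measurable]: "f \<in> borel_measurable M"
  shows "lorentz_norm M p s f \<le> ennreal (lorentz_const p s) * lorentz_dual_norm M p s f"
proof -
  interpret sigma_finite_measure M by fact
  obtain S :: "nat \<Rightarrow> 'a set" where S: "range S \<subseteq> sets M" "(\<Union>i. S i) = space M"
    "\<And>i. emeasure M (S i) \<noteq> \<infinity>" "incseq S"
    by (rule sigma_finite_incseq) blast
  then have [measurable]: "S i \<in> sets M" for i by auto
  define A where "A n = dyadic_level (S n) f n" for n
  define F where "F n = step_fun (A n) (n * 2 ^ n) (dyadic_value n)" for n
  have F: "F n x = (if x \<in> S n \<and> \<bar>f x\<bar> \<le> real n then real_of_int \<lfloor>2 ^ n * \<bar>f x\<bar>\<rfloor> / 2 ^ n else 0)" for n x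
    unfolding F_def A_def by (rule step_fun_dyadic)
  have F0: "0 \<le> F n x" for n x by (simp add: F)
  have Ff: "F n x \<le> \<bar>f x\<bar>" for n x by (simp add: F divide_le_eq mult.commute)
  have A: "level_sets M (A n)" for n
  proof
    have "A n k = {x \<in> space M. x \<in> S n \<and> \<bar>f x\<bar> \<le> real n \<and> \<lfloor>2 ^ n * \<bar>f x\<bar>\<rfloor> = int (n * 2 ^ n) - int k}" for k
      using S(2) by (auto simp: A_def dyadic_level_def)
    then have "A n k \<in> sets M" for k by simp
    moreover have "emeasure M (A n k) < \<infinity>" for k
      using emeasure_mono[of "A n k" "S n" M] S(3)[of n]
      by (auto simp: A_def dyadic_level_def less_top top_unique intro: le_less_trans)
    ultimately show "A n k \<in> fmeasurable M" for k by (simp add: fmeasurable_def)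
    show "disjoint_family (A n)"
      by (auto simp: A_def disjoint_family_on_def dyadic_level_def)
  qed
  have AF: "dyadic_value n k \<le> \<bar>f x\<bar>" if "k < n * 2 ^ n" "x \<in> A n k" for n k x
    using Ff[of n x] step_fun_on[OF level_sets.disj[OF A] that(2), of "n * 2 ^ n" "dyadic_value n"] that
    by (simp add: F_def)
  have bounded: "\<bar>f x\<bar> \<le> real n" if "x \<in> A n k" for n k x
    using that by (simp add: A_def dyadic_level_def)
  have v: "0 \<le> dyadic_value n k" "dyadic_value n (Suc k) \<le> dyadic_value n k"
    "dyadic_value n (n * 2 ^ n) = 0" for n k
    by (auto simp: dyadic_value_def divide_right_mono)
  show ?thesis
  proof (rule lorentz_norm_le_of_approx[where F = F])
    show "f \<in> borel_measurable M" by fact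
    show "F n \<in> borel_measurable M" for n
      unfolding F_def by (rule level_sets.measurable_step_fun[OF A])
    show "\<bar>F n x\<bar> \<le> \<bar>f x\<bar>" for n x using F0 Ff by simp
    show "\<bar>F m x\<bar> \<le> \<bar>F n x\<bar>" if "m \<le> n" for m n x
    proof (cases "x \<in> S m \<and> \<bar>f x\<bar> \<le> real m")
      case True
      then have "x \<in> S n \<and> \<bar>f x\<bar> \<le> real n" using that S(4) by (auto simp: incseq_def)
      then have "F m x \<le> F n x"
        using True dyadic_floor_mono[OF that, of "\<bar>f x\<bar>"] unfolding F by simp
      then show ?thesis using F0 by simp
    next
      case False
      then have "F m x = 0" unfolding F by (rule if_not_P)
      then show ?thesis by simp
    qed
    show "(\<lambda>n. \<bar>F n x\<bar>) \<longlonglongrightarrow> \<bar>f x\<bar>" if x: "x \<in> space M" for x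
    proof -
      obtain i where i: "x \<in> S i" using S(2) x by auto
      obtain j :: nat where j: "\<bar>f x\<bar> \<le> real j" using real_arch_simple by blast
      \<comment> \<open>Once \<open>n\<close> reaches both \<open>i\<close> and \<open>j\<close>,
        neither the restriction nor the truncation affects \<open>x\<close>.\<close>
      have "\<forall>\<^sub>F n in sequentially. real_of_int \<lfloor>2 ^ n * \<bar>f x\<bar>\<rfloor> / 2 ^ n = \<bar>F n x\<bar>"
        using eventually_ge_at_top[of "max i j"]
      proof eventually_elim
        case (elim n)
        then have "x \<in> S n" "\<bar>f x\<bar> \<le> real n" using i j S(4) by (auto simp: incseq_def)
        then show ?case by (simp add: F)
      qed
      from Lim_transform_eventually[OF dyadic_floor_tendsto this] show ?thesis .
    qed
    show "0 < s" using assms(1,2) by (auto intro: le_less_trans)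
    show "lorentz_norm M p s (F n) \<le> ennreal (lorentz_const p s) * lorentz_dual_norm M p s f" for n
    proof (cases s)
      case (real r)
      then have "p < r" using assms by (simp add: ennreal_less_iff)
      then show ?thesis
        unfolding F_def real using assms v AF bounded
        by (intro level_sets.lorentz_norm_step_fun_le_dual[OF A, where c = "real n"]) auto
    next
      case top
      show ?thesis
        unfolding F_def top infinity_ennreal_def[symmetric] using assms v AF bounded
        by (intro level_sets.lorentz_norm_top_step_fun_le_dual[OF A, where c = "real n"]) auto
    qed
  qed
qed

section \<open>Optimality\<close>

text \<open>An atom would be a countable union of pieces of measure at most \<open>e\<close>, each
  too small to carry its full measure and therefore null.\<close>

lemma nonatomic_lborel: "nonatomic (lborel :: real measure)"
  unfolding nonatomic_def atom_of_def
proof clarify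
  fix A :: "real set"
  assume A: "A \<in> sets lborel" "0 < emeasure lborel A"
    and atom: "\<forall>B\<in>sets lborel. B \<subseteq> A \<longrightarrow> emeasure lborel B < emeasure lborel A \<longrightarrow> emeasure lborel B = 0"
  \<comment> \<open>The intermediate \<open>z\<close> yields a finite positive \<open>e\<close> even
    if \<open>A\<close> has infinite measure.\<close>
  obtain z where z: "0 < z" "z < emeasure lborel A" using dense[OF A(2)] by auto
  then obtain e :: real where e: "0 < e" "ennreal e < emeasure lborel A"
    by (cases z) auto
  define B where "B k = A \<inter> {of_int k * e .. (of_int k + 1) * e}" for k :: int
  have B: "B k \<in> sets lborel" for k using A by (simp add: B_def)
  have "emeasure lborel (B k) = 0" for k
  proof -
    have "emeasure lborel (B k) \<le> emeasure lborel {of_int k * e .. (of_int k + 1) * e}"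
      by (intro emeasure_mono) (auto simp: B_def)
    also have "\<dots> = ennreal e" using e by (simp add: algebra_simps)
    finally have "emeasure lborel (B k) < emeasure lborel A" using e by simp
    then show ?thesis using atom B by (auto simp: B_def)
  qed
  then have "(\<Union>k. B k) \<in> null_sets lborel"
    using B by (intro null_sets_UN') auto
  moreover have "(\<Union>k. B k) = A"
  proof (intro set_eqI iffI)
    fix x assume "x \<in> A"
    moreover have "of_int \<lfloor>x / e\<rfloor> * e \<le> x" "x \<le> (of_int \<lfloor>x / e\<rfloor> + 1) * e"
      using e floor_divide_lower[of e x] floor_divide_upper[of e x] by auto
    ultimately show "x \<in> (\<Union>k. B k)" by (auto simp: B_def)
  qed (auto simp: B_def)
  ultimately show False using A by auto
qed

section \<open>Upper bound for the dual norm of the unit interval\<close>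

text \<open>Hardy--Littlewood for an indicator, by slicing both sides into level sets of \<open>g\<close>.\<close>

lemma set_nn_integral_le_rearrangement:
  assumes "sigma_finite_measure M" and g [measurable]: "g \<in> borel_measurable M"
    and E [measurable]: "E \<in> sets M" and e: "emeasure M E \<le> ennreal e" "0 \<le> e"
  shows "(\<integral>\<^sup>+x. ennreal \<bar>g x\<bar> * indicator E x \<partial>M) \<le> (\<integral>\<^sup>+t. rearrangement M g t * indicator {0<..<e} t \<partial>lborel)"
proof -
  interpret M: sigma_finite_measure M by fact
  interpret P: pair_sigma_finite M "lborel :: real measure" by unfold_locales
  define u where "u x y = (if 0 < y \<and> y < \<bar>g x\<bar> \<and> x \<in> E then 1 else 0 :: ennreal)" for x and y :: real
  \<comment> \<open>The inequality for \<open>y\<close> is strict in \<open>u\<close> but weak in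
    \<open>w\<close>, since the argument below shows only that \<open>y\<close> is a lower bound for
    the set whose infimum is the rearrangement.\<close>
  define w where "w t y = (if 0 < y \<and> ennreal y \<le> rearrangement M g t \<and> 0 < t \<and> t < e then 1 else 0 :: ennreal)" for t y
  have u_meas: "case_prod u \<in> borel_measurable (M \<Otimes>\<^sub>M lborel)"
    unfolding u_def by measurable
  have w_meas: "case_prod w \<in> borel_measurable (lborel \<Otimes>\<^sub>M lborel)"
    unfolding w_def by measurable
  have "(\<integral>\<^sup>+x. ennreal \<bar>g x\<bar> * indicator E x \<partial>M) = (\<integral>\<^sup>+x. (\<integral>\<^sup>+y. u x y \<partial>lborel) \<partial>M)"
  proof (intro nn_integral_cong)
    fix x
    have "(\<integral>\<^sup>+y. u x y \<partial>lborel) = (\<integral>\<^sup>+y. indicator {0<..<\<bar>g x\<bar>} y * indicator E x \<partial>lborel)"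
      by (intro nn_integral_cong) (simp add: u_def indicator_def)
    then show "ennreal \<bar>g x\<bar> * indicator E x = (\<integral>\<^sup>+y. u x y \<partial>lborel)"
      by (simp add: nn_integral_multc)
  qed
  also have "\<dots> = (\<integral>\<^sup>+y. (\<integral>\<^sup>+x. u x y \<partial>M) \<partial>lborel)"
    using P.Fubini'[OF u_meas] ..
  also have "\<dots> \<le> (\<integral>\<^sup>+y. (\<integral>\<^sup>+t. w t y \<partial>lborel) \<partial>lborel)"
  proof (rule nn_integral_mono)
    fix y :: real
    show "(\<integral>\<^sup>+x. u x y \<partial>M) \<le> (\<integral>\<^sup>+t. w t y \<partial>lborel)"
    proof (cases "0 < y")
      case True
      have "(\<integral>\<^sup>+x. u x y \<partial>M) = (\<integral>\<^sup>+x. indicator {x \<in> space M. y < \<bar>g x\<bar> \<and> x \<in> E} x \<partial>M)"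
        using True by (intro nn_integral_cong) (simp add: u_def indicator_def)
      also have "\<dots> = emeasure M {x \<in> space M. y < \<bar>g x\<bar> \<and> x \<in> E}" by simp
      finally have u: "(\<integral>\<^sup>+x. u x y \<partial>M) = emeasure M {x \<in> space M. y < \<bar>g x\<bar> \<and> x \<in> E}" .
      have uE: "(\<integral>\<^sup>+x. u x y \<partial>M) \<le> ennreal e"
        unfolding u by (rule order_trans[OF emeasure_mono e(1)]) auto
      have ug: "(\<integral>\<^sup>+x. u x y \<partial>M) \<le> emeasure M {x \<in> space M. y < \<bar>g x\<bar>}"
        unfolding u by (intro emeasure_mono) auto
      obtain r where r: "(\<integral>\<^sup>+x. u x y \<partial>M) = ennreal r" "0 \<le> r"
        using uE by (cases "\<integral>\<^sup>+x. u x y \<partial>M") (auto simp: top_unique)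
      have "r \<le> e" using uE r e by simp
      have "ennreal r = (\<integral>\<^sup>+t. indicator {0<..<r} t \<partial>lborel)" using r by simp
      also have "\<dots> \<le> (\<integral>\<^sup>+t. w t y \<partial>lborel)"
      proof (rule nn_integral_mono)
        fix t :: real
        \<comment> \<open>For \<open>t\<close> below the measure \<open>r\<close> of the slice no
          level \<open>z < y\<close> is admissible.\<close>
        have "ennreal y \<le> rearrangement M g t" if t: "0 < t" "t < r"
          unfolding rearrangement_def
        proof (intro Inf_greatest, clarify)
          fix z :: real assume z: "0 \<le> z" "emeasure M {x \<in> space M. z < \<bar>g x\<bar>} \<le> ennreal t"
          show "ennreal y \<le> ennreal z"
          proof (rule ccontr)
            assume "\<not> ennreal y \<le> ennreal z"
            then have "z < y" using True by (meson ennreal_leI not_le)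
            then have "emeasure M {x \<in> space M. y < \<bar>g x\<bar>} \<le> emeasure M {x \<in> space M. z < \<bar>g x\<bar>}"
              by (intro emeasure_mono) auto
            then have "ennreal r \<le> ennreal t" using ug z r by (metis order_trans)
            then show False using t by simp
          qed
        qed
        then show "indicator {0<..<r} t \<le> w t y"
          using True \<open>r \<le> e\<close> by (auto simp: w_def indicator_def)
      qed
      finally show ?thesis using r by simp
    qed (simp add: u_def)
  qed
  also have "\<dots> = (\<integral>\<^sup>+t. (\<integral>\<^sup>+y. w t y \<partial>lborel) \<partial>lborel)"
    by (rule lborel_pair.Fubini'[OF w_meas])
  also have "\<dots> \<le> (\<integral>\<^sup>+t. rearrangement M g t * indicator {0<..<e} t \<partial>lborel)"
  proof (rule nn_integral_mono)
    fix t :: real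
    show "(\<integral>\<^sup>+y. w t y \<partial>lborel) \<le> rearrangement M g t * indicator {0<..<e} t"
    proof (cases "0 < t \<and> t < e")
      case True
      show ?thesis
      proof (cases "rearrangement M g t")
        case (real b)
        have "(\<integral>\<^sup>+y. w t y \<partial>lborel) = (\<integral>\<^sup>+y. indicator {0<..b} y \<partial>lborel)"
          using True real by (intro nn_integral_cong) (auto simp: w_def indicator_def)
        then show ?thesis using True real by simp
      next
        case top
        then show ?thesis using True by simp
      qed
    next
      case False
      then have "w t y = 0" for y by (auto simp: w_def)
      then show ?thesis by simp
    qed
  qed
  finally show ?thesis .
qed

lemma nn_integral_powr_Ioo_1:
  assumes "0 < a"
  shows "(\<integral>\<^sup>+t. ennreal (t powr (a - 1)) * indicator {0<..<1} t \<partial>lborel) = ennreal (1 / a)"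
proof -
  have "(\<integral>\<^sup>+t. ennreal (t powr (a - 1)) * indicator {0<..<1} t \<partial>lborel)
      = (\<integral>\<^sup>+t. ennreal (t powr (a - 1)) * indicator {0..<1} t \<partial>lborel)"
    by (intro nn_integral_cong) (auto simp: indicator_def)
  then show ?thesis using nn_integral_powr_from_0[of a 1] assms by simp
qed

text \<open>Chebyshev's inequality for the two decreasing functions \<open>X\<close> and \<open>t\<^sup>a\<^sup>-\<^sup>1\<close>: compare \<open>X\<close> with its
  value where \<open>t\<^sup>a\<^sup>-\<^sup>1\<close> attains its mean \<open>1 / a\<close>.\<close>

lemma antimono_nn_integral_weight:
  fixes X :: "real \<Rightarrow> ennreal"
  assumes a: "0 < a" "a < 1" and X: "\<And>t t'. 0 < t \<Longrightarrow> t \<le> t' \<Longrightarrow> X t' \<le> X t"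
    and [measurable]: "X \<in> borel_measurable borel"
    and fin: "(\<integral>\<^sup>+t. X t * ennreal (t powr (a - 1)) * indicator {0<..<1} t \<partial>lborel) < \<infinity>"
  shows "(\<integral>\<^sup>+t. X t * indicator {0<..<1} t \<partial>lborel) * ennreal (1 / a)
    \<le> (\<integral>\<^sup>+t. X t * ennreal (t powr (a - 1)) * indicator {0<..<1} t \<partial>lborel)"
    (is "?J * _ \<le> ?I")
proof -
  define t0 where "t0 = a powr (1 / (1 - a))"
  have t0: "0 < t0" "t0 < 1" using a powr_less_mono2[of "1 / (1 - a)" a 1] by (auto simp: t0_def)
  have "t0 powr (a - 1) = a powr (-1)"
  proof -
    have "1 / (1 - a) * (a - 1) = -1" using a by (simp add: field_simps)
    then show ?thesis by (simp only: t0_def powr_powr)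
  qed
  then have t0a: "t0 powr (a - 1) = 1 / a" using a by (simp add: powr_minus divide_inverse)
  \<comment> \<open>Otherwise \<open>X\<close> would by monotonicity be infinite on all of
    \<open>{0<..<t0}\<close>, and the weighted integral would diverge.\<close>
  have "X t0 \<noteq> \<infinity>"
  proof
    assume inf: "X t0 = \<infinity>"
    have "(\<integral>\<^sup>+t. \<infinity> * indicator {0<..<t0} t \<partial>lborel) \<le> ?I"
    proof (rule nn_integral_mono)
      fix t :: real
      have "X t = \<infinity>" if "0 < t" "t < t0" using X[of t t0] inf that by (simp add: top_unique)
      then show "\<infinity> * indicator {0<..<t0} t \<le> X t * ennreal (t powr (a - 1)) * indicator {0<..<1} t"
        using t0 by (auto simp: indicator_def ennreal_top_mult)
    qed
    moreover have "(\<integral>\<^sup>+t. \<infinity> * indicator {0<..<t0} t \<partial>lborel) = \<infinity>"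
      using t0 by (subst nn_integral_cmult_indicator) (auto simp: ennreal_top_mult)
    ultimately show False using fin by (simp add: top_unique)
  qed
  then obtain K where K: "X t0 = ennreal K" "0 \<le> K" by (cases "X t0") auto
  \<comment> \<open>The finite term \<open>K / a\<close> is added on both sides to avoid
    subtraction; what is integrated is \<open>(X t - K) * (t powr (a - 1) - 1 / a) \<ge> 0\<close>,
    multiplied out.\<close>
  have "?J * ennreal (1 / a) + ennreal K * ennreal (1 / a)
      = (\<integral>\<^sup>+t. X t * indicator {0<..<1} t * ennreal (1 / a)
          + ennreal K * (ennreal (t powr (a - 1)) * indicator {0<..<1} t) \<partial>lborel)"
    using nn_integral_powr_Ioo_1[OF a(1)] by (simp add: nn_integral_add nn_integral_multc nn_integral_cmult)
  also have "\<dots> \<le> (\<integral>\<^sup>+t. X t * ennreal (t powr (a - 1)) * indicator {0<..<1} t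
          + ennreal (K * (1 / a)) * indicator {0<..<1} t \<partial>lborel)"
  proof (rule nn_integral_mono)
    fix t :: real
    have "X t * ennreal (1 / a) + ennreal K * ennreal (t powr (a - 1))
        \<le> X t * ennreal (t powr (a - 1)) + ennreal (K * (1 / a))" if t: "0 < t" "t < 1"
    proof (cases "X t")
      case (real x)
      have "0 \<le> (x - K) * (t powr (a - 1) - 1 / a)"
      proof (cases "t \<le> t0")
        case True
        then have "K \<le> x" using X[of t t0] t K real by simp
        moreover have "1 / a \<le> t powr (a - 1)"
          unfolding t0a[symmetric] using t True a by (intro powr_mono2') auto
        ultimately show ?thesis by simp
      next
        case False
        then have "x \<le> K" using X[of t0 t] t t0 K real by simp
        moreover have "t powr (a - 1) \<le> 1 / a"
          unfolding t0a[symmetric] using t0 False a by (intro powr_mono2') auto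
        ultimately show ?thesis by (simp add: mult_nonpos_nonpos)
      qed
      then have "x * (1 / a) + K * t powr (a - 1) \<le> x * t powr (a - 1) + K * (1 / a)"
        by (simp add: algebra_simps diff_divide_distrib)
      then have "ennreal (x * (1 / a) + K * t powr (a - 1)) \<le> ennreal (x * t powr (a - 1) + K * (1 / a))"
        by (rule ennreal_leI)
      then show ?thesis using real K a
        by (simp add: ennreal_mult[symmetric] ennreal_plus[symmetric] del: ennreal_plus)
    next
      case top
      then show ?thesis using t by (simp add: ennreal_top_mult)
    qed
    then show "X t * indicator {0<..<1} t * ennreal (1 / a)
          + ennreal K * (ennreal (t powr (a - 1)) * indicator {0<..<1} t)
        \<le> X t * ennreal (t powr (a - 1)) * indicator {0<..<1} t + ennreal (K * (1 / a)) * indicator {0<..<1} t"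
      by (simp add: indicator_def)
  qed
  also have "\<dots> = ?I + ennreal K * ennreal (1 / a)"
    using K a by (simp add: nn_integral_add nn_integral_cmult_indicator ennreal_mult[symmetric])
  finally have "ennreal K * ennreal (1 / a) + ?J * ennreal (1 / a) \<le> ennreal K * ennreal (1 / a) + ?I"
    by (simp add: add.commute)
  then show ?thesis
    by (simp add: ennreal_add_left_cancel_le ennreal_mult_eq_top_iff)
qed

text \<open>The Hardy-Littlewood bound reduces the claim to the integral of the rearrangement over
  the unit interval; Chebyshev's inequality bounds that of its power \<open>X\<close> by
  \<open>\<sigma> / P\<close>, and convexity of the power finishes.\<close>

lemma set_nn_integral_le_lorentz_norm:
  fixes P \<sigma> :: real
  assumes M: "sigma_finite_measure M" and g [measurable]: "g \<in> borel_measurable M"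
    and E: "E \<in> sets M" "emeasure M E \<le> 1"
    and \<sigma>: "1 \<le> \<sigma>" "\<sigma> < P" and norm: "lorentz_norm M P (ennreal \<sigma>) g = 1"
  shows "(\<integral>\<^sup>+x. ennreal \<bar>g x\<bar> * indicator E x \<partial>M) \<le> ennreal ((\<sigma> / P) powr (1 / \<sigma>))"
proof -
  define a where "a = \<sigma> / P"
  define m where "m = a powr (1 / \<sigma>)"
  define G where "G = rearrangement M g"
  define X where "X t = ennreal_powr (G t) \<sigma>" for t
  have a: "0 < a" "a < 1" using \<sigma> by (auto simp: a_def)
  have m: "0 < m" "m powr \<sigma> = a" using a \<sigma> by (auto simp: m_def powr_powr)
  have [measurable]: "G \<in> borel_measurable borel" unfolding G_def by simp
  have [measurable]: "X \<in> borel_measurable borel" unfolding X_def using \<sigma> by (intro measurable_compose[OF _ measurable_ennreal_powr]) auto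
  define I where "I = (\<integral>\<^sup>+t\<in>{0<..}. ennreal_powr (ennreal (t powr (1 / P)) * G t) \<sigma> * ennreal (1 / t) \<partial>lborel)"
  have "ennreal_powr I (1 / \<sigma>) = 1"
    using norm \<sigma> by (simp add: lorentz_norm_def I_def G_def)
  moreover have "ennreal_powr 1 \<sigma> = 1" by (simp add: ennreal_powr_def)
  ultimately have I: "I = 1" using ennreal_powr_powr[of \<sigma> I] \<sigma> by simp
  have "(\<integral>\<^sup>+t. X t * ennreal (t powr (a - 1)) * indicator {0<..<1} t \<partial>lborel) \<le> I"
    unfolding I_def
  proof (rule nn_integral_mono)
    fix t :: real
    have "X t * ennreal (t powr (a - 1)) = ennreal_powr (ennreal (t powr (1 / P)) * G t) \<sigma> * ennreal (1 / t)"
      if t: "0 < t"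
    proof (cases "G t")
      case (real b)
      have "(t powr (1 / P) * b) powr \<sigma> * (1 / t) = b powr \<sigma> * t powr (a - 1)"
        using real t by (simp add: powr_mult powr_powr powr_diff a_def)
      then show ?thesis
        using real t by (simp add: X_def ennreal_powr_ennreal ennreal_mult[symmetric] ennreal_mult''[symmetric])
    next
      case top
      then show ?thesis using t by (simp add: X_def ennreal_powr_def ennreal_mult_top ennreal_top_mult)
    qed
    then show "X t * ennreal (t powr (a - 1)) * indicator {0<..<1} t
        \<le> ennreal_powr (ennreal (t powr (1 / P)) * G t) \<sigma> * ennreal (1 / t) * indicator {0<..} t"
      by (auto simp: indicator_def)
  qed
  then have weighted: "(\<integral>\<^sup>+t. X t * ennreal (t powr (a - 1)) * indicator {0<..<1} t \<partial>lborel) \<le> 1"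
    by (simp add: I)
  define J where "J = (\<integral>\<^sup>+t. X t * indicator {0<..<1} t \<partial>lborel)"
  have "J * ennreal (1 / a) \<le> 1"
    unfolding J_def
  proof (rule order_trans[OF antimono_nn_integral_weight[OF a] weighted])
    show "X t' \<le> X t" if "t \<le> t'" for t t'
      unfolding X_def G_def using \<sigma> that by (intro ennreal_powr_mono rearrangement_antimono) auto
  qed (use weighted in \<open>auto intro: le_less_trans\<close>)
  then have "J * ennreal (1 / a) * ennreal a \<le> 1 * ennreal a" by (rule mult_right_mono) simp
  then have J: "J \<le> ennreal a"
    using a by (simp add: mult.assoc ennreal_mult[symmetric])
  \<comment> \<open>Coefficients of the bound \<open>x \<le> c1 * x powr \<sigma> + c2\<close>, with
    equality at \<open>x = m\<close>. Integrated over the unit interval it gives at most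
    \<open>c1 * a + c2 = m\<close>, which is Jensen's inequality in the form needed.\<close>
  define c1 c2 where "c1 = 1 / (\<sigma> * m powr (\<sigma> - 1))" and "c2 = (1 - 1 / \<sigma>) * m"
  have c: "0 \<le> c1" "0 \<le> c2" using \<sigma> m by (auto simp: c1_def c2_def)
  have "c1 * a + c2 = m"
    using \<sigma> m by (simp add: c1_def c2_def m(2)[symmetric] powr_diff field_simps)
  have tangent: "x \<le> x powr \<sigma> * c1 + c2" if "0 \<le> x" for x
  proof -
    \<comment> \<open>The case \<open>\<sigma> = 1\<close>, which arises from
      \<open>s = \<infinity>\<close>, is trivial and lies outside \<open>young_powr\<close>.\<close>
    have "\<sigma> * x * m powr (\<sigma> - 1) \<le> x powr \<sigma> + (\<sigma> - 1) * m powr \<sigma>"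
      using young_powr[of \<sigma> x m] that \<sigma> m by (cases "\<sigma> = 1") auto
    then have "(\<sigma> * x * m powr (\<sigma> - 1)) * c1 \<le> (x powr \<sigma> + (\<sigma> - 1) * m powr \<sigma>) * c1"
      using c by (intro mult_right_mono)
    moreover have "(\<sigma> * x * m powr (\<sigma> - 1)) * c1 = x" using m \<sigma> by (simp add: c1_def)
    moreover have "(\<sigma> - 1) * m powr \<sigma> * c1 = c2"
      using m(1) \<sigma> by (simp add: c1_def c2_def powr_diff field_simps)
    ultimately show ?thesis by (simp add: distrib_right)
  qed
  have "(\<integral>\<^sup>+x. ennreal \<bar>g x\<bar> * indicator E x \<partial>M) \<le> (\<integral>\<^sup>+t. G t * indicator {0<..<1} t \<partial>lborel)"
    unfolding G_def using E by (intro set_nn_integral_le_rearrangement M g) auto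
  also have "\<dots> \<le> (\<integral>\<^sup>+t. X t * indicator {0<..<1} t * ennreal c1 + ennreal c2 * indicator {0<..<1} t \<partial>lborel)"
  proof (rule nn_integral_mono)
    fix t :: real
    have "G t \<le> X t * ennreal c1 + ennreal c2"
    proof (cases "G t")
      case (real b)
      then show ?thesis
        using tangent[of b] c
        by (simp add: X_def ennreal_powr_ennreal ennreal_mult[symmetric] ennreal_plus[symmetric] del: ennreal_plus)
    next
      case top
      have "0 < c1" using \<sigma> m by (simp add: c1_def)
      then show ?thesis using top by (simp add: X_def ennreal_powr_def ennreal_top_mult)
    qed
    then show "G t * indicator {0<..<1} t
        \<le> X t * indicator {0<..<1} t * ennreal c1 + ennreal c2 * indicator {0<..<1} t"
      by (simp add: indicator_def)
  qed
  also have "\<dots> = J * ennreal c1 + ennreal c2"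
    by (simp add: J_def nn_integral_add nn_integral_multc nn_integral_cmult_indicator)
  also have "\<dots> \<le> ennreal a * ennreal c1 + ennreal c2"
    using J by (intro add_right_mono mult_right_mono) auto
  also have "\<dots> = ennreal m"
    using a c \<open>c1 * a + c2 = m\<close>
    by (simp add: ennreal_mult[symmetric] ennreal_plus[symmetric] mult.commute del: ennreal_plus)
  finally show ?thesis by (simp add: m_def a_def)
qed

text \<open>The interval has measure 1, so the preceding bound applies to every admissible
  \<open>g\<close>; if the product is not integrable, its Bochner integral is 0.\<close>

lemma lorentz_dual_norm_unit_interval_le:
  assumes "1 \<le> \<sigma>" "\<sigma> < conj_exponent p" "conj_exponent_ext s = ennreal \<sigma>"
  shows "lorentz_dual_norm lborel p s (indicator {0..1 :: real})
    \<le> ennreal ((\<sigma> / conj_exponent p) powr (1 / \<sigma>))"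
  unfolding lorentz_dual_norm_def
proof (rule Sup_least, clarify)
  fix g :: "real \<Rightarrow> real"
  assume g: "g \<in> lorentz_space lborel (conj_exponent p) (conj_exponent_ext s)"
    "lorentz_norm lborel (conj_exponent p) (conj_exponent_ext s) g = 1"
  have "ennreal (\<integral>x. indicator {0..1} x * g x \<partial>lborel) \<le> (\<integral>\<^sup>+x. ennreal \<bar>g x\<bar> * indicator {0..1} x \<partial>lborel)"
  proof (cases "integrable lborel (\<lambda>x. indicator {0..1} x * g x)")
    case True
    have "ennreal (\<integral>x. indicator {0..1} x * g x \<partial>lborel) \<le> ennreal (norm (\<integral>x. indicator {0..1} x * g x \<partial>lborel))"
      by (intro ennreal_leI) auto
    also have "\<dots> \<le> (\<integral>\<^sup>+x. ennreal (norm (indicator {0..1} x * g x)) \<partial>lborel)"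
      using True by (rule integral_norm_bound_ennreal)
    also have "\<dots> = (\<integral>\<^sup>+x. ennreal \<bar>g x\<bar> * indicator {0..1} x \<partial>lborel)"
      by (intro nn_integral_cong) (auto simp: indicator_def)
    finally show ?thesis .
  qed (simp add: not_integrable_integral_eq)
  also have "\<dots> \<le> ennreal ((\<sigma> / conj_exponent p) powr (1 / \<sigma>))"
    using g assms by (intro set_nn_integral_le_lorentz_norm) (auto simp: lorentz_space_def sigma_finite_lborel)
  finally show "ennreal (\<integral>x. indicator {0..1} x * g x \<partial>lborel) \<le> ennreal ((\<sigma> / conj_exponent p) powr (1 / \<sigma>))" .
qed

lemma lorentz_norm_unit_interval:
  fixes p :: real
  assumes p: "0 < p" and s: "0 < s"
  shows "lorentz_norm lborel p s (indicator {0..1 :: real})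
    = ennreal (if s = \<infinity> then 1 else (p / enn2real s) powr (1 / enn2real s))"
proof -
  define A where "A k = (if k = 0 then {0..1 :: real} else {})" for k :: nat
  interpret level_sets lborel A
    by standard (auto simp: A_def disjoint_family_on_def fmeasurable_def)
  have f: "indicator {0..1 :: real} = step_fun A 1 (\<lambda>_. 1)"
    by (auto simp: step_fun_def A_def fun_eq_iff)
  have T1: "T (Suc 0) = 1" by (simp add: cum_measure_def A_def)
  show ?thesis
  proof (cases s)
    case (real r)
    then have "0 < r" using s by simp
    then show ?thesis
      unfolding f real using p by (subst lorentz_norm_step_fun) (auto simp: T1)
  next
    case top
    define F where "F = step_fun A 1 (\<lambda>_. 1)"
    have R: "rearrangement lborel F t = (if t < 1 then 1 else 0)" if "0 < t" for t
      using rearrangement_step_fun[of 1 "\<lambda>_. 1" 0 t] rearrangement_step_fun_beyond[of 1 t "\<lambda>_. 1"] that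
      by (simp add: T1 F_def)
    have "(SUP t\<in>{0<..}. ennreal (t powr (1 / p)) * rearrangement lborel F t) = 1"
    proof (rule antisym)
      show "(SUP t\<in>{0<..}. ennreal (t powr (1 / p)) * rearrangement lborel F t) \<le> 1"
        using p by (intro SUP_least) (auto simp: R powr_le1)
      show "1 \<le> (SUP t\<in>{0<..}. ennreal (t powr (1 / p)) * rearrangement lborel F t)"
      \<comment> \<open>The supremum is not attained, as the rearrangement vanishes from
        \<open>t = 1\<close> on; it is approached along \<open>t = y powr p\<close> with
        \<open>y < 1\<close>.\<close>
      proof (rule dense_le)
        fix z :: ennreal assume "z < 1"
        then obtain y where y: "z = ennreal y" "0 \<le> y" "y < 1" by (cases z) auto
        show "z \<le> (SUP t\<in>{0<..}. ennreal (t powr (1 / p)) * rearrangement lborel F t)"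
        proof (cases "y = 0")
          case False
          then have "0 < y powr p" "y powr p < 1" "(y powr p) powr (1 / p) = y"
            using y p powr_less_mono2[of p y 1] by (auto simp: powr_powr)
          then show ?thesis
            by (intro SUP_upper2[of "y powr p"]) (auto simp: R y)
        qed (simp add: y)
      qed
    qed
    then show ?thesis by (simp add: f top lorentz_norm_def F_def)
  qed
qed

text \<open>The indicator of the unit interval has norm \<open>N\<close> and dual norm at most
  \<open>m\<close>, and \<open>N / m\<close> is the constant.\<close>

theorem lorentz_const_optimal:
  fixes p :: real and s :: ennreal
  assumes p: "1 < p" and s: "ennreal p < s"
    and C: "\<And>(M :: real measure) f. sigma_finite_measure M \<Longrightarrow> nonatomic M \<Longrightarrow> f \<in> lorentz_space M p s \<Longrightarrow>
      lorentz_norm M p s f \<le> ennreal C * lorentz_dual_norm M p s f"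
  shows "lorentz_const p s \<le> C"
proof -
  define \<sigma> where "\<sigma> = enn2real (conj_exponent_ext s)"
  define N where "N = (if s = \<infinity> then 1 else (p / enn2real s) powr (1 / enn2real s))"
  define m where "m = (\<sigma> / conj_exponent p) powr (1 / \<sigma>)"
  have \<sigma>: "1 \<le> \<sigma> \<and> \<sigma> < conj_exponent p \<and> conj_exponent_ext s = ennreal \<sigma>"
  proof (cases s)
    case (real r)
    then have r: "p < r" using s p by (simp add: ennreal_less_iff)
    then have "conj_exponent_ext s = ennreal (r / (r - 1))"
      using real p by (simp add: conj_exponent_ext_def conj_exponent_def)
    moreover have "1 \<le> r / (r - 1)" "r / (r - 1) < p / (p - 1)"
      using r p by (auto simp: field_simps)
    ultimately show ?thesis by (simp add: \<sigma>_def conj_exponent_def)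
  next
    case top
    then show ?thesis using p by (simp add: \<sigma>_def conj_exponent_ext_def conj_exponent_def)
  qed
  have s0: "0 < s" using s by (auto intro: le_less_trans)
  have norm: "lorentz_norm lborel p s (indicator {0..1 :: real}) = ennreal N"
    unfolding N_def using p s0 by (intro lorentz_norm_unit_interval) auto
  have N: "0 < N" using p s0 by (cases s) (auto simp: N_def)
  have m: "0 < m" using \<sigma> by (auto simp: m_def)
  have "ennreal N \<le> ennreal C * lorentz_dual_norm lborel p s (indicator {0..1 :: real})"
    unfolding norm[symmetric]
    by (rule C) (auto simp: sigma_finite_lborel nonatomic_lborel lorentz_space_def norm)
  also have "\<dots> \<le> ennreal C * ennreal m"
    unfolding m_def using \<sigma> by (intro mult_left_mono lorentz_dual_norm_unit_interval_le) auto
  also have "\<dots> = ennreal (C * m)" using m by (simp add: ennreal_mult'')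
  \<comment> \<open>Since \<open>N > 0\<close>, this also excludes a negative \<open>C\<close>,
    which \<open>ennreal\<close> would send to 0.\<close>
  finally have "N \<le> C * m" using N by (simp add: ennreal_le_iff2)
  moreover have "lorentz_const p s = N / m"
    using \<sigma> by (simp add: lorentz_const_def N_def m_def \<sigma>_def[symmetric] Let_def powr_divide)
  ultimately show ?thesis using m by (simp add: pos_divide_le_eq)
qed

text \<open>Types cannot be quantified inside the formula, so optimality is tested on measures over
  the reals; a constant valid for all spaces is in particular valid for these.\<close>

theorem theorem4p4:
  fixes p :: real and s :: ennreal
  assumes "1 < p" and "ennreal p < s"
  shows "(\<forall>(M :: 'a measure) f. sigma_finite_measure M \<longrightarrow> nonatomic M \<longrightarrow> f \<in> lorentz_space M p s \<longrightarrow>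
           lorentz_norm M p s f \<le> ennreal (lorentz_const p s) * lorentz_dual_norm M p s f) \<and>
         (\<forall>C :: real.
           (\<forall>(M :: real measure) f. sigma_finite_measure M \<longrightarrow> nonatomic M \<longrightarrow> f \<in> lorentz_space M p s \<longrightarrow>
              lorentz_norm M p s f \<le> ennreal C * lorentz_dual_norm M p s f)
           \<longrightarrow> lorentz_const p s \<le> C)"
  using lorentz_norm_le_dual_norm[OF assms] lorentz_const_optimal[OF assms]
  by (auto simp: lorentz_space_def)

end
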